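(* For the rotating Kepler problem the flag curvature can become negative: with angular velocity $a=1$, there exist an energy parameter $c>\frac32$, a point $(x,y)$ with $x>0$, and a nonzero tangent vector $(u,v)$ at that point with $v\neq 0$, such that the flag curvature $K$ of the Finsler metric $F$ Legendre dual to $F^*_{c,1}$ satisfies $K(x,y,u,v)<0$.
   Context: Polar coordinates $(x,y)$ on the $p$-plane ($p_1=x\cos y$, $p_2=x\sin y$), with cotangent fiber coordinates $(r,t)$ defined by $r\,dx+t\,dy=q_1dp_1+q_2dp_2$ and tangent fiber coordinates $(u,v)$. The Cartan fundamental function of the rotating Kepler problem (angular velocity $1$, energy $-c$, $c>3/2$) is $$F^*_{c,1}(x,y,r,t)=\frac14(x^2+2c)\sqrt{r^2+\tfrac{t^2}{x^2}}\left(1+\sqrt{1-\frac{16\,t}{\sqrt{r^2+\frac{t^2}{x^2}}\,(x^2+2c)^2}}\right),$$ which is fiberwise strictly convex and positively $1$-homogeneous. Let $\mathcal{L}^*=\frac12(F^*_{c,1})^2$, let $\mathcal{L}(x,y,u,v)=\frac12F^2$ be its fiberwise Legendre transform ($u=\mathcal{L}^*_r$, $v=\mathcal{L}^*_t$), so $F$ is a Finsler metric. Let $D=\mathcal{L}_{uu}\mathcal{L}_{vv}-\mathcal{L}_{uv}^2$ and define spray coefficients $$2G=\tfrac{1}{D}\big(\mathcal{L}_{vv}\mathcal{L}_x-\mathcal{L}_{vx}\mathcal{L}_v-\mathcal{L}_{uv}\mathcal{L}_y+\mathcal{L}_{uy}\mathcal{L}_v\big),\quad 2H=\tfrac{1}{D}\big(\mathcal{L}_{uu}\mathcal{L}_y-\mathcal{L}_{uy}\mathcal{L}_u-\mathcal{L}_{vu}\mathcal{L}_x+\mathcal{L}_{vx}\mathcal{L}_u\big).$$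 The flag curvature (a function on the slit tangent bundle of the surface; subscripts are partial derivatives in the independent variables $x,y,u,v$) is, where $v\neq0$, $$K=\frac{(G_{xv}-G_{yu})\,v+2GG_{uu}+2HG_{uv}-G_uG_u-G_vH_u}{v\,\mathcal{L}_v}.$$ *)

theory Defs
  imports "HOL-Analysis.Analysis"
begin

text \<open>Functions of the four coordinates (x, y, fiber1, fiber2) on the (co)tangent bundle
  of the polar-coordinate chart.\<close>
type_synonym rf4 = "real \<Rightarrow> real \<Rightarrow> real \<Rightarrow> real \<Rightarrow> real"

definition D1 :: "rf4 \<Rightarrow> rf4" where
  "D1 f = (\<lambda>x y u v. deriv (\<lambda>s. f s y u v) x)"
definition D2 :: "rf4 \<Rightarrow> rf4" where
  "D2 f = (\<lambda>x y u v. deriv (\<lambda>s. f x s u v) y)"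
definition D3 :: "rf4 \<Rightarrow> rf4" where
  "D3 f = (\<lambda>x y u v. deriv (\<lambda>s. f x y s v) u)"
definition D4 :: "rf4 \<Rightarrow> rf4" where
  "D4 f = (\<lambda>x y u v. deriv (\<lambda>s. f x y u s) v)"

text \<open>Cartan fundamental function of the rotating Kepler problem, angular velocity 1,
  energy -c; arguments x y r t.\<close>
definition Fstar :: "real \<Rightarrow> rf4" where
  "Fstar c = (\<lambda>x y r t.
     1/4 * (x\<^sup>2 + 2*c) * sqrt (r\<^sup>2 + t\<^sup>2 / x\<^sup>2) *
     (1 + sqrt (1 - 16 * t / (sqrt (r\<^sup>2 + t\<^sup>2 / x\<^sup>2) * (x\<^sup>2 + 2*c)\<^sup>2))))"

definition Lstar :: "real \<Rightarrow> rf4" where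
  "Lstar c = (\<lambda>x y r t. (Fstar c x y r t)\<^sup>2 / 2)"

definition Lleg :: "real \<Rightarrow> rf4" where
  "Lleg c = (\<lambda>x y u v.
     (let p = (THE p. D3 (Lstar c) x y (fst p) (snd p) = u \<and> D4 (Lstar c) x y (fst p) (snd p) = v)
      in fst p * u + snd p * v - Lstar c x y (fst p) (snd p)))"

definition detL :: "real \<Rightarrow> rf4" where
  "detL c = (\<lambda>x y u v. D3 (D3 (Lleg c)) x y u v * D4 (D4 (Lleg c)) x y u v
                       - (D4 (D3 (Lleg c)) x y u v)\<^sup>2)"

text \<open>Spray coefficients G and H (the displayed formulas give 2G and 2H).\<close>
definition sprayG :: "real \<Rightarrow> rf4" where
  "sprayG c = (\<lambda>x y u v. let L = Lleg c in
     (1 / detL c x y u v) *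
       (D4 (D4 L) x y u v * D1 L x y u v - D1 (D4 L) x y u v * D4 L x y u v
        - D4 (D3 L) x y u v * D2 L x y u v + D2 (D3 L) x y u v * D4 L x y u v) / 2)"

definition sprayH :: "real \<Rightarrow> rf4" where
  "sprayH c = (\<lambda>x y u v. let L = Lleg c in
     (1 / detL c x y u v) *
       (D3 (D3 L) x y u v * D2 L x y u v - D2 (D3 L) x y u v * D3 L x y u v
        - D3 (D4 L) x y u v * D1 L x y u v + D1 (D4 L) x y u v * D3 L x y u v) / 2)"

text \<open>Flag curvature (valid where v \<noteq> 0).\<close>
definition flagK :: "real \<Rightarrow> rf4" where
  "flagK c = (\<lambda>x y u v. let G = sprayG c; H = sprayH c; L = Lleg c in
     ((D4 (D1 G) x y u v - D3 (D2 G) x y u v) * v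
      + 2 * G x y u v * D3 (D3 G) x y u v + 2 * H x y u v * D4 (D3 G) x y u v
      - D3 G x y u v * D3 G x y u v - D4 G x y u v * D3 H x y u v)
     / (v * D4 L x y u v))"

end

theory Submission
  imports Defs
begin

text \<open>
  In orthonormal fibre coordinates \<open>p = (r, t/x)\<close> the Cartan function is a multiple of
  \<open>norm p * (1 + sqrt (1 - a \<bullet> sgn p))\<close> with \<open>norm a < 1\<close>. Its strict convexity makes the Legendre map
  injective, so that the definite description in the Legendre transform is harmless.

  The Hamiltonian \<open>E\<close> (half the square of the Cartan function) does not depend on \<open>y\<close> and is even in \<open>r\<close>,
  so for \<open>t > 0\<close> it has the form \<open>E = t\<^sup>2 m(x, k)\<close> with \<open>k = r\<^sup>2/t\<^sup>2\<close>. Hamilton's equations and \<open>x'' = -2 G\<close>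
  give \<open>2 G = E\<^sub>r\<^sub>r E\<^sub>x - E\<^sub>r\<^sub>x E\<^sub>r\<close>, and similarly for \<open>H\<close>. Hence \<open>G/v\<^sup>2\<close> and \<open>H/(u v)\<close> are functions of \<open>(x, k)\<close>
  that involve only second derivatives of \<open>m\<close>. At \<open>u = 0\<close>, that is at \<open>k = 0\<close>, the third derivatives
  drop out of the curvature as well:
  \<open>K = m\<^sub>k m\<^sub>x\<^sub>x / m + m\<^sub>x m\<^sub>k\<^sub>x / (2 m) - 3 m\<^sub>k m\<^sub>x\<^sup>2 / (2 m\<^sup>2) + 3 m\<^sub>x\<^sup>2 m\<^sub>k\<^sub>k / (2 m m\<^sub>k)\<close>.
  At \<open>c = 38/25\<close>, \<open>x = 3/5\<close>, where \<open>(x\<^sup>2 + 2c)\<^sup>2 - 16 x\<close> is the square of a rational, this is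
  \<open>-8856/1225\<close>.
\<close>

section \<open>Tilted norms\<close>

definition tilt :: "'a::real_inner \<Rightarrow> 'a \<Rightarrow> real" where
  "tilt a p = sqrt (1 - a \<bullet> sgn p)"

definition tilted_norm :: "'a::real_inner \<Rightarrow> 'a \<Rightarrow> real" where
  "tilted_norm a p = norm p * (1 + tilt a p)"

definition tilted_norm_gradient :: "'a::real_inner \<Rightarrow> 'a \<Rightarrow> 'a" where
  "tilted_norm_gradient a p = ((1 + tilt a p)\<^sup>2 *\<^sub>R sgn p - a) /\<^sub>R (2 * tilt a p)"

definition tilted_norm_legendre :: "'a::real_inner \<Rightarrow> 'a \<Rightarrow> 'a" where
  "tilted_norm_legendre a p = tilted_norm a p *\<^sub>R tilted_norm_gradient a p"

lemma norm_mult_inner_sgn: "norm p * (q \<bullet> sgn p) = q \<bullet> p" for p q :: "'a::real_inner"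
  by (cases "p = 0") (simp_all add: sgn_div_norm)

lemma inner_sgn_self: "sgn p \<bullet> p = norm p" for p :: "'a::real_inner"
  using norm_mult_inner_sgn[of p p]
  by (cases "p = 0") (simp_all add: inner_commute power2_norm_eq_inner[symmetric] power2_eq_square)

lemma inner_sgn_le_norm: "sgn p \<bullet> q \<le> norm q" for p q :: "'a::real_inner"
  using norm_cauchy_schwarz[of "sgn p" q] by (simp add: norm_sgn split: if_splits)

lemma tilt_pos:
  assumes "norm a < 1"
  shows "tilt a p > 0"
  using inner_sgn_le_norm[of p a] assms by (simp add: tilt_def inner_commute)

lemma tilt_square:
  assumes "norm a < 1"
  shows "(tilt a p)\<^sup>2 = 1 - a \<bullet> sgn p"
  using tilt_pos[OF assms, of p] by (simp add: tilt_def)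

lemma tilted_norm_0 [simp]: "tilted_norm a 0 = 0"
  by (simp add: tilted_norm_def)

lemma tilted_norm_pos:
  assumes "norm a < 1" "p \<noteq> 0"
  shows "tilted_norm a p > 0"
  using tilt_pos[OF assms(1), of p] assms(2) by (simp add: tilted_norm_def)

lemma tilted_norm_le:
  assumes "norm a \<le> 1"
  shows "tilted_norm a p \<le> 3 * norm p"
proof -
  have "- (a \<bullet> sgn p) \<le> norm a"
    using inner_sgn_le_norm[of p "- a"] by (simp add: inner_commute)
  then have "tilt a p \<le> 2"
    using assms unfolding tilt_def by (intro real_le_lsqrt) auto
  then have "norm p * (1 + tilt a p) \<le> norm p * 3"
    by (intro mult_left_mono) auto
  then show ?thesis by (simp add: tilted_norm_def mult.commute)
qed

lemma tilted_norm_gradient_inner: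
  "tilted_norm_gradient a p \<bullet> h = ((1 + tilt a p)\<^sup>2 * (sgn p \<bullet> h) - a \<bullet> h) / (2 * tilt a p)"
  by (simp add: tilted_norm_gradient_def inner_diff_left divide_simps)

lemma tilted_norm_gradient_inner_self:
  assumes "norm a < 1"
  shows "tilted_norm_gradient a p \<bullet> p = tilted_norm a p"
proof -
  have "a \<bullet> p = norm p * (1 - (tilt a p)\<^sup>2)"
    by (simp add: tilt_square[OF assms] norm_mult_inner_sgn)
  then show ?thesis
    using tilt_pos[OF assms, of p]
    by (simp add: tilted_norm_gradient_inner tilted_norm_def inner_sgn_self field_simps power2_eq_square)
qed

lemma tilted_norm_has_derivative:
  assumes a: "norm a < 1" and p: "p \<noteq> 0"
  shows "(tilted_norm a has_derivative (\<lambda>h. tilted_norm_gradient a p \<bullet> h)) (at p)"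
proof -
  define g where "g = tilt a p"
  have g: "g > 0" "g = sqrt (1 - a \<bullet> p / norm p)" and ap: "a \<bullet> p = norm p * (1 - g\<^sup>2)"
    using tilt_pos[OF a, of p] p norm_mult_inner_sgn[of p a]
    by (simp_all add: g_def tilt_def sgn_div_norm field_simps)
  have "((\<lambda>p. norm p * (1 + sqrt (1 - a \<bullet> p / norm p))) has_derivative
     (\<lambda>h. (h \<bullet> sgn p) * (1 + g) +
       norm p * (- ((a \<bullet> h) * norm p - (a \<bullet> p) * (h \<bullet> sgn p)) / (norm p * norm p) / (2 * g)))) (at p)"
    using p g by (auto intro!: derivative_eq_intros has_derivative_norm simp: fun_eq_iff field_simps)
  moreover have "(h \<bullet> sgn p) * (1 + g) +
       norm p * (- ((a \<bullet> h) * norm p - (a \<bullet> p) * (h \<bullet> sgn p)) / (norm p * norm p) / (2 * g))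
    = tilted_norm_gradient a p \<bullet> h" for h
    unfolding tilted_norm_gradient_inner ap
    using g(1) p by (simp add: g_def[symmetric] inner_commute field_simps power2_eq_square)
  moreover have "a \<bullet> sgn p = a \<bullet> p / norm p" for p
    by (simp add: sgn_div_norm divide_inverse mult.commute)
  ultimately show ?thesis
    by (simp add: tilted_norm_def[abs_def] tilt_def)
qed

lemma tilted_norm_square_has_derivative:
  assumes a: "norm a < 1"
  shows "((\<lambda>p. (tilted_norm a p)\<^sup>2 / 2) has_derivative
    (\<lambda>h. tilted_norm_legendre a p \<bullet> h)) (at p)"
proof (cases "p = 0")
  case False
  then show ?thesis
    by (auto intro!: derivative_eq_intros tilted_norm_has_derivative[OF a]
        simp: fun_eq_iff tilted_norm_legendre_def)
next
  case True
  have "0 \<le> tilted_norm a q" for q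
    using tilt_pos[OF a, of q] by (simp add: tilted_norm_def)
  then have bound: "(tilted_norm a q)\<^sup>2 \<le> (3 * norm q)\<^sup>2" for q
    using tilted_norm_le[of a q] a by (intro power_mono) auto
  have "((\<lambda>q. norm ((tilted_norm a q)\<^sup>2 / 2) / norm q) \<longlongrightarrow> 0) (at 0)"
  proof (rule Lim_null_comparison)
    show "((\<lambda>q. 9/2 * norm q) \<longlongrightarrow> 0) (at (0::'a))"
      by (intro tendsto_mult_right_zero tendsto_norm_zero tendsto_ident_at)
    show "\<forall>\<^sub>F q in at 0. norm (norm ((tilted_norm a q)\<^sup>2 / 2) / norm q) \<le> 9/2 * norm q"
      using bound by (intro always_eventually) (simp add: divide_simps power2_eq_square mult_ac)
  qed
  then show ?thesis
    using True by (simp add: has_derivative_at tilted_norm_legendre_def)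
qed

text \<open>\<open>sqrt (1 - a \<bullet> s)\<close> is \<open>1 / sqrt 2\<close> times the distance of \<open>(s, 0)\<close> from the fixed point
  \<open>(a, - sqrt (1 - (norm a)\<^sup>2))\<close>, so this is the triangle inequality.\<close>

lemma sqrt_one_minus_inner_diff_le:
  fixes a p q :: "'a::real_inner"
  assumes "norm a \<le> 1" "norm p = 1" "norm q = 1"
  shows "(sqrt (1 - a \<bullet> p) - sqrt (1 - a \<bullet> q))\<^sup>2 \<le> 1 - p \<bullet> q"
proof -
  define b where "b = sqrt (1 - (norm a)\<^sup>2)"
  have b: "b\<^sup>2 = 1 - (norm a)\<^sup>2"
    using assms by (simp add: b_def power_le_one)
  have sqrt_eq: "sqrt (1 - a \<bullet> s) = norm (s - a, b) / sqrt 2" if "norm s = 1" for s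
  proof -
    have "(norm (s - a))\<^sup>2 + b\<^sup>2 = (1 - a \<bullet> s) * 2"
      using that b by (simp add: power2_norm_eq_inner inner_diff inner_commute norm_eq_1)
    then show ?thesis by (simp only: norm_Pair real_norm_def power2_abs real_sqrt_mult) simp
  qed
  have "\<bar>norm (p - a, b) - norm (q - a, b)\<bar> \<le> norm (p - q)"
    using norm_triangle_ineq3[of "(p - a, b)" "(q - a, b)"] by (simp add: norm_Pair)
  then have "(norm (p - a, b) - norm (q - a, b))\<^sup>2 \<le> (norm (p - q))\<^sup>2"
    by (simp add: abs_le_square_iff[symmetric])
  also have "(norm (p - q))\<^sup>2 = 2 * (1 - p \<bullet> q)"
    using assms by (simp add: power2_norm_eq_inner inner_diff inner_commute norm_eq_1)
  finally show ?thesis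
    using assms by (simp add: sqrt_eq diff_divide_distrib[symmetric] power_divide)
qed

lemma tilted_norm_gradient_inner_le:
  assumes a: "norm a < 1" and p: "p \<noteq> 0"
  shows "tilted_norm_gradient a p \<bullet> q + (norm q - sgn p \<bullet> q) \<le> tilted_norm a q"
proof (cases "q = 0")
  case False
  define g h C where "g = tilt a p" and "h = tilt a q" and "C = sgn p \<bullet> sgn q"
  have g: "g > 0" and h: "a \<bullet> sgn q = 1 - h\<^sup>2"
    using tilt_pos[OF a] tilt_square[OF a] by (simp_all add: g_def h_def)
  have C: "C \<le> 1"
    unfolding C_def using inner_sgn_le_norm[of p "sgn q"] False by (simp add: norm_sgn)
  have "(g - h)\<^sup>2 \<le> 1 - C"
    unfolding g_def h_def C_def tilt_def
    using a p False by (intro sqrt_one_minus_inner_diff_le) (auto simp: norm_sgn)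
  also have "\<dots> \<le> (1 - C) * (1 + g\<^sup>2)"
    using C by (simp add: mult_le_cancel_left1)
  finally have "(1 + g)\<^sup>2 * C - a \<bullet> sgn q \<le> 2 * g * (C + h)"
    unfolding h by (simp add: power2_eq_square algebra_simps)
  then have "tilted_norm_gradient a p \<bullet> sgn q \<le> C + h"
    using g by (simp add: tilted_norm_gradient_inner C_def g_def field_simps)
  then have "norm q * (tilted_norm_gradient a p \<bullet> sgn q) \<le> norm q * (C + h)"
    by (rule mult_left_mono) simp
  then show ?thesis
    by (simp add: norm_mult_inner_sgn tilted_norm_def C_def h_def algebra_simps)
qed simp

lemma tilted_norm_legendre_inner_self:
  assumes "norm a < 1"
  shows "tilted_norm_legendre a p \<bullet> p = (tilted_norm a p)\<^sup>2"
  by (simp add: tilted_norm_legendre_def tilted_norm_gradient_inner_self[OF assms] power2_eq_square)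

lemma tilted_norm_legendre_inner_le:
  assumes a: "norm a < 1"
  shows "tilted_norm_legendre a p \<bullet> q \<le> tilted_norm a p * tilted_norm a q"
proof (cases "p = 0")
  case False
  then have "tilted_norm_gradient a p \<bullet> q \<le> tilted_norm a q"
    using tilted_norm_gradient_inner_le[OF a False, of q] inner_sgn_le_norm[of p q] by linarith
  then show ?thesis
    using tilted_norm_pos[OF a False] by (simp add: tilted_norm_legendre_def)
qed (simp add: tilted_norm_legendre_def)

lemma tilted_norm_legendre_inner_eq_imp_parallel:
  assumes a: "norm a < 1" and p: "p \<noteq> 0"
    and eq: "tilted_norm_legendre a p \<bullet> q = tilted_norm a p * tilted_norm a q"
  shows "q = norm q *\<^sub>R sgn p"
proof -
  have "tilted_norm_gradient a p \<bullet> q = tilted_norm a q"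
    using eq tilted_norm_pos[OF a p] by (simp add: tilted_norm_legendre_def)
  then have "sgn p \<bullet> q = norm (sgn p) * norm q"
    using tilted_norm_gradient_inner_le[OF a p, of q] inner_sgn_le_norm[of p q] p
    by (simp add: norm_sgn)
  then have "norm (sgn p) *\<^sub>R q = norm q *\<^sub>R sgn p"
    by (rule norm_cauchy_schwarz_eq[THEN iffD1])
  then show ?thesis using p by (simp add: norm_sgn)
qed

lemma inj_tilted_norm_legendre:
  assumes a: "norm a < 1"
  shows "inj (tilted_norm_legendre a)"
proof (rule injI)
  fix p q
  assume T_eq: "tilted_norm_legendre a p = tilted_norm_legendre a q"
  note T_self = tilted_norm_legendre_inner_self[OF a] and T_le = tilted_norm_legendre_inner_le[OF a]
  have N_pos: "tilted_norm a s > 0" if "s \<noteq> 0" for s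
    using a that by (rule tilted_norm_pos)
  show "p = q"
  proof (cases "p = 0 \<or> q = 0")
    case True
    have "tilted_norm_legendre a s = 0 \<longleftrightarrow> s = 0" for s
      using T_self[of s] N_pos[of s]
      by (metis inner_zero_left less_irrefl power_not_zero tilted_norm_0 tilted_norm_legendre_def
          scaleR_zero_left)
    then show ?thesis using True T_eq by metis
  next
    case False
    have "tilted_norm a q * tilted_norm a q \<le> tilted_norm a p * tilted_norm a q"
      and "tilted_norm a p * tilted_norm a p \<le> tilted_norm a q * tilted_norm a p"
      using T_self[of p] T_self[of q] T_le[of p q] T_le[of q p]
      by (simp_all add: T_eq power2_eq_square)
    then have N_eq: "tilted_norm a p = tilted_norm a q"
      using False N_pos[of p] N_pos[of q] by simp
    then have q_eq: "q = norm q *\<^sub>R sgn p"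
      using T_self[of q] False
      by (intro tilted_norm_legendre_inner_eq_imp_parallel[OF a])
        (simp_all add: T_eq power2_eq_square)
    then have "sgn q = sgn p"
      using False by (metis norm_eq_zero sgn_div_norm scaleR_scaleR left_inverse scaleR_one)
    then have "tilt a q = tilt a p" by (simp add: tilt_def)
    then have "norm p = norm q"
      using N_eq tilt_pos[OF a, of p] by (simp add: tilted_norm_def)
    then show ?thesis using q_eq False by (simp add: sgn_div_norm)
  qed
qed

section \<open>Functions of two real variables\<close>

definition has_gradient :: "(real \<Rightarrow> real \<Rightarrow> real) \<Rightarrow> real \<times> real \<Rightarrow> real \<times> real \<Rightarrow> bool"
    (infix "(has'_gradient)" 50) where
  "(f has_gradient g) p \<longleftrightarrow>
    ((\<lambda>q. f (fst q) (snd q)) has_derivative (\<lambda>h. fst g * fst h + snd g * snd h)) (at p)"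

lemma has_gradient_eq_rhs:
  "(f has_gradient (a, b)) p \<Longrightarrow> a = a' \<Longrightarrow> b = b' \<Longrightarrow> (f has_gradient (a', b')) p"
  by simp

lemma has_gradient_snd: "((\<lambda>x k. k) has_gradient (0, 1)) p"
  by (auto simp: has_gradient_def intro!: derivative_eq_intros)

lemma has_gradient_of_fst:
  assumes "(\<phi> has_real_derivative d) (at x)"
  shows "((\<lambda>x k. \<phi> x) has_gradient (d, 0)) (x, k)"
  using DERIV_compose_FDERIV[OF _ has_derivative_fst[OF has_derivative_ident], of \<phi> d "(x, k)" UNIV] assms
  by (simp add: has_gradient_def mult.commute)

lemma has_gradient_add:
  assumes "(f has_gradient (a, b)) (x, k)" "(g has_gradient (a', b')) (x, k)"
  shows "((\<lambda>x k. f x k + g x k) has_gradient (a + a', b + b')) (x, k)"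
  using has_derivative_add[OF assms[unfolded has_gradient_def]]
  by (simp add: has_gradient_def algebra_simps)

lemma has_gradient_diff:
  assumes "(f has_gradient (a, b)) (x, k)" "(g has_gradient (a', b')) (x, k)"
  shows "((\<lambda>x k. f x k - g x k) has_gradient (a - a', b - b')) (x, k)"
  using has_derivative_diff[OF assms[unfolded has_gradient_def]]
  by (simp add: has_gradient_def algebra_simps)

lemma has_gradient_mult:
  assumes "(f has_gradient (a, b)) (x, k)" "(g has_gradient (a', b')) (x, k)"
  shows "((\<lambda>x k. f x k * g x k) has_gradient
    (a * g x k + f x k * a', b * g x k + f x k * b')) (x, k)"
  using has_derivative_mult[OF assms[unfolded has_gradient_def]]
  by (simp add: has_gradient_def algebra_simps)

lemma has_gradient_divide:
  assumes "(f has_gradient (a, b)) (x, k)" "(g has_gradient (a', b')) (x, k)" "g x k \<noteq> 0"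
  shows "((\<lambda>x k. f x k / g x k) has_gradient
    ((a * g x k - f x k * a') / (g x k)\<^sup>2, (b * g x k - f x k * b') / (g x k)\<^sup>2)) (x, k)"
  using has_derivative_divide'[OF assms(1,2)[unfolded has_gradient_def]] assms(3)
  by (simp add: has_gradient_def power2_eq_square algebra_simps diff_divide_distrib add_divide_distrib)

lemma has_gradient_compose:
  assumes "(f has_gradient (a, b)) (x, k)" "(\<phi> has_real_derivative d) (at (f x k))"
  shows "((\<lambda>x k. \<phi> (f x k)) has_gradient (d * a, d * b)) (x, k)"
  using DERIV_compose_FDERIV[OF _ assms(1)[unfolded has_gradient_def], of \<phi> d] assms(2)
  by (simp add: has_gradient_def algebra_simps)

lemma has_gradient_power2:
  assumes "(f has_gradient (a, b)) (x, k)"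
  shows "((\<lambda>x k. (f x k)\<^sup>2) has_gradient (2 * f x k * a, 2 * f x k * b)) (x, k)"
  by (rule has_gradient_compose[OF assms]) (auto intro!: derivative_eq_intros)

lemma has_gradient_cmult:
  assumes "(f has_gradient (a, b)) (x, k)"
  shows "((\<lambda>x k. c * f x k) has_gradient (c * a, c * b)) (x, k)"
  using has_gradient_compose[OF assms DERIV_cmult_Id] .

lemma has_gradient_chain:
  assumes "(f has_gradient (a, b)) (g s, k s)"
    and "(g has_real_derivative g') (at s)" "(k has_real_derivative k') (at s)"
  shows "((\<lambda>s. f (g s) (k s)) has_real_derivative a * g' + b * k') (at s)"
proof -
  have "((\<lambda>s. (g s, k s)) has_derivative (\<lambda>h. (g' * h, k' * h))) (at s)"
    using assms(2,3) by (auto intro!: derivative_eq_intros simp: has_field_derivative_def)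
  from has_derivative_compose[OF this assms(1)[unfolded has_gradient_def]]
  have "((\<lambda>s. f (g s) (k s)) has_derivative (\<lambda>h. a * (g' * h) + b * (k' * h))) (at s)" by simp
  moreover have "(\<lambda>h. a * (g' * h) + b * (k' * h)) = (*) (a * g' + b * k')"
    by (simp add: fun_eq_iff algebra_simps)
  ultimately show ?thesis by (simp add: has_field_derivative_def)
qed

lemma has_gradient_partial1:
  "(f has_gradient (a, b)) (x, k) \<Longrightarrow> ((\<lambda>s. f s k) has_real_derivative a) (at x)"
  using has_gradient_chain[of f a b "\<lambda>s. s" x "\<lambda>_. k" 1 0] by simp

lemma has_gradient_partial2:
  "(f has_gradient (a, b)) (x, k) \<Longrightarrow> (f x has_real_derivative b) (at k)"
  using has_gradient_chain[of f a b "\<lambda>_. x" k "\<lambda>s. s" 0 1] by simp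

text \<open>No continuity of the partial derivatives is needed: strict monotonicity on the fibres gives
  injectivity, and invariance of domain replaces the contraction argument.\<close>

lemma fibrewise_inverse:
  fixes y y_x y_k :: "real \<Rightarrow> real \<Rightarrow> real"
  assumes M: "open M" and fibre: "\<And>x. is_interval {k. (x, k) \<in> M}"
    and gradient: "\<And>x k. (x, k) \<in> M \<Longrightarrow> (y has_gradient (y_x x k, y_k x k)) (x, k)"
    and pos: "\<And>x k. (x, k) \<in> M \<Longrightarrow> y_k x k > 0"
  defines "\<Phi> \<equiv> \<lambda>p. (fst p, y (fst p) (snd p))"
  shows "inj_on \<Phi> M" and "open (\<Phi> ` M)"
    and "\<And>x k. (x, k) \<in> M \<Longrightarrow>
      ((\<lambda>x n. snd (inv_into M \<Phi> (x, n))) has_gradient (- y_x x k / y_k x k, 1 / y_k x k)) (x, y x k)"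
proof -
  have fibre_strict_mono: "y x k < y x k'" if "(x, k) \<in> M" "(x, k') \<in> M" "k < k'" for x k k'
  proof (rule DERIV_pos_imp_increasing[OF that(3)])
    fix l assume "k \<le> l" "l \<le> k'"
    then have "l \<in> {k. (x, k) \<in> M}"
      using fibre[of x] that(1,2) unfolding is_interval_1 by blast
    then have "(x, l) \<in> M" by simp
    then show "\<exists>d. ((\<lambda>k. y x k) has_real_derivative d) (at l) \<and> 0 < d"
      using has_gradient_partial2[OF gradient] pos by blast
  qed
  show inj: "inj_on \<Phi> M"
  proof (rule inj_onI, clarify)
    fix x k x' k' assume "(x, k) \<in> M" "(x', k') \<in> M" "\<Phi> (x, k) = \<Phi> (x', k')"
    then show "x = x' \<and> k = k'"
      using fibre_strict_mono[of x k k'] fibre_strict_mono[of x k' k] linorder_less_linear[of k k']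
      by (auto simp: \<Phi>_def)
  qed
  have derivative: "(\<Phi> has_derivative (\<lambda>h. (fst h, y_x x k * fst h + y_k x k * snd h))) (at (x, k))"
    if "(x, k) \<in> M" for x k
    unfolding \<Phi>_def using gradient[OF that]
    by (auto intro!: derivative_eq_intros simp: has_gradient_def)
  have cont: "continuous_on M \<Phi>"
    using derivative M by (auto simp: continuous_on_eq_continuous_at intro: has_derivative_continuous)
  show "open (\<Phi> ` M)" using cont M inj by (rule invariance_of_domain)
  show "((\<lambda>x n. snd (inv_into M \<Phi> (x, n))) has_gradient (- y_x x k / y_k x k, 1 / y_k x k)) (x, y x k)"
    if xk: "(x, k) \<in> M" for x k
  proof -
    have "(inv_into M \<Phi> has_derivative (\<lambda>h. (fst h, - y_x x k / y_k x k * fst h + 1 / y_k x k * snd h)))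
        (at (\<Phi> (x, k)))"
      by (rule has_derivative_inverse_strong[OF M xk cont inv_into_f_f[OF inj] derivative[OF xk]])
        (use pos[OF xk] in \<open>auto simp: fun_eq_iff field_simps\<close>)
    from has_derivative_snd[OF this] show ?thesis
      by (simp add: has_gradient_def \<Phi>_def)
  qed
qed

lemma C1_differentiable_on_power [derivative_intros]:
  fixes f :: "real \<Rightarrow> 'a::real_normed_field"
  assumes "f C1_differentiable_on S"
  shows "(\<lambda>s. f s ^ n) C1_differentiable_on S"
  by (induction n) (simp_all add: assms)

lemma C1_differentiable_on_realI:
  assumes "\<And>s. s \<in> S \<Longrightarrow> (f has_real_derivative f' s) (at s)" "continuous_on S f'"
  shows "f C1_differentiable_on S"
  using assms unfolding C1_differentiable_on_def has_real_derivative_iff_has_vector_derivative by blast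

lemma C1_differentiable_on_realE:
  assumes "f C1_differentiable_on S"
  obtains f' where "\<And>s. s \<in> S \<Longrightarrow> (f has_real_derivative f' s) (at s)" "continuous_on S f'"
  using assms unfolding C1_differentiable_on_def has_real_derivative_iff_has_vector_derivative by blast

lemma C1_differentiable_on_divide [derivative_intros]:
  fixes f g :: "real \<Rightarrow> real"
  assumes f: "f C1_differentiable_on S" and g: "g C1_differentiable_on S"
    and nz: "\<And>s. s \<in> S \<Longrightarrow> g s \<noteq> 0"
  shows "(\<lambda>s. f s / g s) C1_differentiable_on S"
proof -
  obtain f' g' where f': "\<And>s. s \<in> S \<Longrightarrow> (f has_real_derivative f' s) (at s)" "continuous_on S f'"
    and g': "\<And>s. s \<in> S \<Longrightarrow> (g has_real_derivative g' s) (at s)" "continuous_on S g'"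
    using f g by (auto elim!: C1_differentiable_on_realE)
  show ?thesis
  proof (rule C1_differentiable_on_realI)
    show "((\<lambda>s. f s / g s) has_real_derivative (f' s * g s - f s * g' s) / (g s * g s)) (at s)"
      if "s \<in> S" for s using that f' g' nz by (intro DERIV_divide) auto
    show "continuous_on S (\<lambda>s. (f' s * g s - f s * g' s) / (g s * g s))"
      using f' g' nz C1_differentiable_imp_continuous_on[OF f] C1_differentiable_imp_continuous_on[OF g]
      by (intro continuous_intros) auto
  qed
qed

lemma C1_differentiable_on_sqrt [derivative_intros]:
  assumes f: "f C1_differentiable_on S" and pos: "\<And>s. s \<in> S \<Longrightarrow> f s > 0"
  shows "(\<lambda>s. sqrt (f s)) C1_differentiable_on S"
proof -
  obtain f' where f': "\<And>s. s \<in> S \<Longrightarrow> (f has_real_derivative f' s) (at s)" "continuous_on S f'"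
    using f by (auto elim!: C1_differentiable_on_realE)
  show ?thesis
  proof (rule C1_differentiable_on_realI)
    show "((\<lambda>s. sqrt (f s)) has_real_derivative f' s / (2 * sqrt (f s))) (at s)" if "s \<in> S" for s
      using DERIV_chain2[OF DERIV_real_sqrt[OF pos[OF that]] f'(1)[OF that]] by (simp add: field_simps)
    show "continuous_on S (\<lambda>s. f' s / (2 * sqrt (f s)))"
      using f'(2) pos C1_differentiable_imp_continuous_on[OF f]
      by (intro continuous_intros) (auto dest: pos)
  qed
qed

lemma DERIV_ident_mult_at_0:
  fixes f :: "'a::real_normed_field \<Rightarrow> 'a"
  assumes "isCont f 0"
  shows "((\<lambda>s. s * f s) has_field_derivative f 0) (at 0)"
  unfolding CARAT_DERIV using assms by (intro exI[of _ f]) simp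

section \<open>Spray and curvature of a Lagrangian\<close>

lemma D1_eqI:
  assumes "\<forall>\<^sub>F s in nhds x. f s y u v = g s" "(g has_real_derivative d) (at x)"
  shows "D1 f x y u v = d"
  unfolding D1_def using deriv_cong_ev[OF assms(1) refl] DERIV_imp_deriv[OF assms(2)] by simp

lemma D2_eqI:
  assumes "\<forall>\<^sub>F s in nhds y. f x s u v = g s" "(g has_real_derivative d) (at y)"
  shows "D2 f x y u v = d"
  unfolding D2_def using deriv_cong_ev[OF assms(1) refl] DERIV_imp_deriv[OF assms(2)] by simp

lemma D3_eqI:
  assumes "\<forall>\<^sub>F s in nhds u. f x y s v = g s" "(g has_real_derivative d) (at u)"
  shows "D3 f x y u v = d"
  unfolding D3_def using deriv_cong_ev[OF assms(1) refl] DERIV_imp_deriv[OF assms(2)] by simp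

lemma D4_eqI:
  assumes "\<forall>\<^sub>F s in nhds v. f x y u s = g s" "(g has_real_derivative d) (at v)"
  shows "D4 f x y u v = d"
  unfolding D4_def using deriv_cong_ev[OF assms(1) refl] DERIV_imp_deriv[OF assms(2)] by simp

definition fibre_legendre :: "rf4 \<Rightarrow> rf4" where
  "fibre_legendre E = (\<lambda>x y u v.
     let p = THE p. D3 E x y (fst p) (snd p) = u \<and> D4 E x y (fst p) (snd p) = v
     in fst p * u + snd p * v - E x y (fst p) (snd p))"

definition fibre_hessian :: "rf4 \<Rightarrow> rf4" where
  "fibre_hessian L = (\<lambda>x y u v.
     D3 (D3 L) x y u v * D4 (D4 L) x y u v - (D4 (D3 L) x y u v)\<^sup>2)"

definition spray_x :: "rf4 \<Rightarrow> rf4" where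
  "spray_x L = (\<lambda>x y u v. (1 / fibre_hessian L x y u v) *
     (D4 (D4 L) x y u v * D1 L x y u v - D1 (D4 L) x y u v * D4 L x y u v
      - D4 (D3 L) x y u v * D2 L x y u v + D2 (D3 L) x y u v * D4 L x y u v) / 2)"

definition spray_y :: "rf4 \<Rightarrow> rf4" where
  "spray_y L = (\<lambda>x y u v. (1 / fibre_hessian L x y u v) *
     (D3 (D3 L) x y u v * D2 L x y u v - D2 (D3 L) x y u v * D3 L x y u v
      - D3 (D4 L) x y u v * D1 L x y u v + D1 (D4 L) x y u v * D3 L x y u v) / 2)"

definition flag_curvature :: "rf4 \<Rightarrow> rf4" where
  "flag_curvature L = (\<lambda>x y u v. let G = spray_x L; H = spray_y L in
     ((D4 (D1 G) x y u v - D3 (D2 G) x y u v) * v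
      + 2 * G x y u v * D3 (D3 G) x y u v + 2 * H x y u v * D4 (D3 G) x y u v
      - D3 G x y u v * D3 G x y u v - D4 G x y u v * D3 H x y u v)
     / (v * D4 L x y u v))"

lemma flagK_eq: "flagK c = flag_curvature (fibre_legendre (Lstar c))"
proof -
  have "Lleg c = fibre_legendre (Lstar c)"
    by (simp add: Lleg_def fibre_legendre_def)
  moreover have "sprayG c = spray_x (Lleg c)" "sprayH c = spray_y (Lleg c)"
    by (simp_all add: sprayG_def spray_x_def sprayH_def spray_y_def fibre_hessian_def detL_def Let_def)
  ultimately show ?thesis
    by (simp add: flagK_def flag_curvature_def Let_def)
qed

section \<open>Rotation-invariant Lagrangians with a dual profile\<close>

text \<open>
  The Hamiltonian is \<open>E(x, r, t) = t\<^sup>2 m(x, r\<^sup>2/t\<^sup>2)\<close>, and \<open>m_x\<close>, \<open>m_k\<close>, \<open>m_kx\<close>, \<open>m_kk\<close> are partial derivatives of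
  \<open>m\<close>. Below, \<open>axial\<close> is \<open>E\<^sub>t / (2 t)\<close>, \<open>hess\<close> is a quarter of the determinant of the fibre
  Hessian of \<open>E\<close>, and \<open>slope\<close> expresses \<open>u\<^sup>2/v\<^sup>2\<close> by \<open>k = r\<^sup>2/t\<^sup>2\<close>, with inverse \<open>kappa\<close>. Values \<open>k < 0\<close>
  correspond to no covector, but they make \<open>k = 0\<close> an interior point.
\<close>

locale even_profile =
  fixes M :: "(real \<times> real) set" and m m_x m_k m_kx m_kk :: "real \<Rightarrow> real \<Rightarrow> real"
  assumes open_M: "open M" and is_interval_fibre: "is_interval {k. (x, k) \<in> M}"
    and m_has_gradient: "(x, k) \<in> M \<Longrightarrow> (m has_gradient (m_x x k, m_k x k)) (x, k)"
    and m_k_has_gradient: "(x, k) \<in> M \<Longrightarrow> (m_k has_gradient (m_kx x k, m_kk x k)) (x, k)"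
    and m_k_pos: "(x, k) \<in> M \<Longrightarrow> m_k x k > 0"
    and m_minus_k_m_k_pos: "(x, k) \<in> M \<Longrightarrow> m x k - k * m_k x k > 0"
    and hessian_pos: "(x, k) \<in> M \<Longrightarrow> m_k x k * (m x k - k * m_k x k) + 2 * k * m x k * m_kk x k > 0"
begin

definition axial :: "real \<Rightarrow> real \<Rightarrow> real" where
  "axial x k = m x k - k * m_k x k"

definition hess :: "real \<Rightarrow> real \<Rightarrow> real" where
  "hess x k = m_k x k * axial x k + 2 * k * m x k * m_kk x k"

definition slope :: "real \<Rightarrow> real \<Rightarrow> real" where
  "slope x k = k * (m_k x k / axial x k)\<^sup>2"

definition slope_map :: "real \<times> real \<Rightarrow> real \<times> real" where
  "slope_map p = (fst p, slope (fst p) (snd p))"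

definition cone :: "real \<Rightarrow> real \<Rightarrow> real \<Rightarrow> bool" where
  "cone x u v \<longleftrightarrow> v > 0 \<and> (x, u\<^sup>2 / v\<^sup>2) \<in> slope_map ` M"

definition kappa :: "real \<Rightarrow> real \<Rightarrow> real \<Rightarrow> real" where
  "kappa x u v = snd (inv_into M slope_map (x, u\<^sup>2 / v\<^sup>2))"

definition kappa_x :: "real \<Rightarrow> real \<Rightarrow> real" where
  "kappa_x x k = - 2 * k * (m x k * m_kx x k - m_k x k * m_x x k) / hess x k"

definition kappa_u :: "real \<Rightarrow> real \<Rightarrow> real \<Rightarrow> real \<Rightarrow> real" where
  "kappa_u x k u v = 2 * u * axial x k ^ 3 / (v\<^sup>2 * m_k x k * hess x k)"

definition kappa_v :: "real \<Rightarrow> real \<Rightarrow> real \<Rightarrow> real" where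
  "kappa_v x k v = - 2 * k * m_k x k * axial x k / (v * hess x k)"

lemma m_eq_axial: "m x k = axial x k + k * m_k x k"
  by (simp add: axial_def)

lemma axial_pos: "(x, k) \<in> M \<Longrightarrow> axial x k > 0"
  using m_minus_k_m_k_pos by (simp add: axial_def)

lemma hess_pos: "(x, k) \<in> M \<Longrightarrow> hess x k > 0"
  using hessian_pos by (simp add: hess_def axial_def)

lemma axial_has_gradient:
  assumes "(x, k) \<in> M"
  shows "(axial has_gradient (m_x x k - k * m_kx x k, - k * m_kk x k)) (x, k)"
  unfolding axial_def
  by (rule has_gradient_eq_rhs[OF has_gradient_diff[OF m_has_gradient[OF assms]
        has_gradient_mult[OF has_gradient_snd m_k_has_gradient[OF assms]]]]) simp_all

lemma slope_has_gradient:
  assumes "(x, k) \<in> M"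
  shows "(slope has_gradient
     (2 * k * m_k x k * (m x k * m_kx x k - m_k x k * m_x x k) / axial x k ^ 3,
      m_k x k * hess x k / axial x k ^ 3)) (x, k)"
proof -
  have a: "axial x k \<noteq> 0" using axial_pos[OF assms] by simp
  then show ?thesis
    unfolding slope_def hess_def m_eq_axial[of x k]
    by (intro has_gradient_eq_rhs[OF has_gradient_mult[OF has_gradient_snd
          has_gradient_power2[OF has_gradient_divide[OF m_k_has_gradient[OF assms]
              axial_has_gradient[OF assms] a]]]])
      (simp_all add: field_simps power2_eq_square power3_eq_cube)
qed

lemma slope_k_pos:
  assumes "(x, k) \<in> M"
  shows "m_k x k * hess x k / axial x k ^ 3 > 0"
  using m_k_pos[OF assms] axial_pos[OF assms] hess_pos[OF assms] by simp

lemma slope_map_inverse: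
  shows "open (slope_map ` M)"
    and "(x, k) \<in> M \<Longrightarrow> ((\<lambda>x n. snd (inv_into M slope_map (x, n))) has_gradient
      (kappa_x x k, axial x k ^ 3 / (m_k x k * hess x k))) (x, slope x k)"
proof -
  note inverse = fibrewise_inverse[OF open_M is_interval_fibre slope_has_gradient slope_k_pos,
      folded slope_map_def[abs_def]]
  show "open (slope_map ` M)"
    using inverse(2) by blast
  show "((\<lambda>x n. snd (inv_into M slope_map (x, n))) has_gradient
      (kappa_x x k, axial x k ^ 3 / (m_k x k * hess x k))) (x, slope x k)" if M: "(x, k) \<in> M"
    using inverse(3)[OF _ _ M] axial_pos[OF M] m_k_pos[OF M] by (simp add: kappa_x_def mult.assoc)
qed

lemma cone_pos: "cone x u v \<Longrightarrow> v > 0"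
  by (simp add: cone_def)

lemma slope_map_kappa:
  assumes "cone x u v"
  shows "(x, kappa x u v) \<in> M" and "slope x (kappa x u v) = u\<^sup>2 / v\<^sup>2"
proof -
  have im: "(x, u\<^sup>2 / v\<^sup>2) \<in> slope_map ` M" using assms by (simp add: cone_def)
  have inv: "inv_into M slope_map (x, u\<^sup>2 / v\<^sup>2) = (x, kappa x u v)"
    using f_inv_into_f[OF im] by (simp add: kappa_def slope_map_def prod_eq_iff)
  show "(x, kappa x u v) \<in> M" using inv_into_into[OF im] by (simp add: inv)
  show "slope x (kappa x u v) = u\<^sup>2 / v\<^sup>2"
    using f_inv_into_f[OF im] unfolding inv by (simp add: slope_map_def)
qed

lemma cone_square_eq:
  assumes cone: "cone x u v" and k: "k = kappa x u v"
  shows "u\<^sup>2 = v\<^sup>2 * (k * (m_k x k)\<^sup>2 / (axial x k)\<^sup>2)"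
  using slope_map_kappa(2)[OF cone] cone_pos[OF cone] by (simp add: slope_def k field_simps)

lemma cone_profile_pos:
  assumes "cone x u v" and "k = kappa x u v"
  shows "v > 0" "m_k x k > 0" "axial x k > 0" "hess x k > 0"
  using assms cone_pos m_k_pos axial_pos hess_pos slope_map_kappa(1) by blast+

lemma eventually_cone:
  assumes "cone x u v"
  shows "\<forall>\<^sub>F s in nhds x. cone s u v" and "\<forall>\<^sub>F s in nhds u. cone x s v" and "\<forall>\<^sub>F s in nhds v. cone x u s"
proof -
  have v: "v > 0" and im: "(x, u\<^sup>2 / v\<^sup>2) \<in> slope_map ` M" using assms by (simp_all add: cone_def)
  have U: "open (slope_map ` M)" using slope_map_inverse(1) .
  have "((\<lambda>s. (s, u\<^sup>2 / v\<^sup>2)) \<longlongrightarrow> (x, u\<^sup>2 / v\<^sup>2)) (nhds x)"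
       "((\<lambda>s. (x, s\<^sup>2 / v\<^sup>2)) \<longlongrightarrow> (x, u\<^sup>2 / v\<^sup>2)) (nhds u)"
       "((\<lambda>s. (x, u\<^sup>2 / s\<^sup>2)) \<longlongrightarrow> (x, u\<^sup>2 / v\<^sup>2)) (nhds v)"
    using v by (auto intro!: tendsto_intros filterlim_ident)
  note ev = this[THEN topological_tendstoD, OF U im]
  show "\<forall>\<^sub>F s in nhds x. cone s u v" "\<forall>\<^sub>F s in nhds u. cone x s v"
    using ev(1,2) v by (simp_all add: cone_def)
  show "\<forall>\<^sub>F s in nhds v. cone x u s"
    using ev(3) order_tendstoD(1)[OF filterlim_ident v] by eventually_elim (simp add: cone_def)
qed

lemma kappa_has_derivative:
  assumes cone: "cone x u v" and k: "k = kappa x u v"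
  shows "((\<lambda>s. kappa s u v) has_real_derivative kappa_x x k) (at x)"
    and "((\<lambda>s. kappa x s v) has_real_derivative kappa_u x k u v) (at u)"
    and "((\<lambda>s. kappa x u s) has_real_derivative kappa_v x k v) (at v)"
proof -
  define kappa_n where "kappa_n = axial x k ^ 3 / (m_k x k * hess x k)"
  note M = slope_map_kappa(1)[OF cone, folded k] and slope = slope_map_kappa(2)[OF cone, folded k]
    and pos = cone_profile_pos[OF cone k]
  have gradient: "((\<lambda>x n. snd (inv_into M slope_map (x, n))) has_gradient (kappa_x x k, kappa_n))
      (x, u\<^sup>2 / v\<^sup>2)"
    using slope_map_inverse(2)[OF M] by (simp only: slope kappa_n_def)
  show "((\<lambda>s. kappa s u v) has_real_derivative kappa_x x k) (at x)"
    unfolding kappa_def using has_gradient_partial1[OF gradient] .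
  have "((\<lambda>s. s\<^sup>2 / v\<^sup>2) has_real_derivative 2 * u / v\<^sup>2) (at u)"
    by (rule DERIV_cdivide) (auto intro!: derivative_eq_intros)
  from DERIV_chain2[OF has_gradient_partial2[OF gradient] this]
  show "((\<lambda>s. kappa x s v) has_real_derivative kappa_u x k u v) (at u)"
    unfolding kappa_def by (simp add: kappa_u_def kappa_n_def mult_ac)
  have "((\<lambda>s. u\<^sup>2 / s\<^sup>2) has_real_derivative - 2 * u\<^sup>2 / v ^ 3) (at v)"
    using pos by (auto intro!: derivative_eq_intros simp: field_simps numeral_eq_Suc)
  from DERIV_chain2[OF has_gradient_partial2[OF gradient] this]
  have "((\<lambda>s. kappa x u s) has_real_derivative kappa_n * (- 2 * u\<^sup>2 / v ^ 3)) (at v)"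
    unfolding kappa_def .
  also have "kappa_n * (- 2 * u\<^sup>2 / v ^ 3) = kappa_v x k v"
    unfolding cone_square_eq[OF cone k] kappa_n_def kappa_v_def
    using pos by (simp add: field_simps power2_eq_square power3_eq_cube)
  finally show "((\<lambda>s. kappa x u s) has_real_derivative kappa_v x k v) (at v)" .
qed

lemma cone_D1:
  assumes cone: "cone x u v" and k: "k = kappa x u v" and \<phi>: "(\<phi> has_gradient (b, b')) (x, k)"
    and f: "\<And>x. cone x u v \<Longrightarrow> f x y u v = a * \<phi> x (kappa x u v)"
  shows "D1 f x y u v = a * (b + b' * kappa_x x k)"
proof (rule D1_eqI[OF eventually_mono[OF eventually_cone(1)[OF cone]]])
  show "f s y u v = a * \<phi> s (kappa s u v)" if "cone s u v" for s using f[OF that] .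
  show "((\<lambda>s. a * \<phi> s (kappa s u v)) has_real_derivative
      a * (b + b' * kappa_x x k)) (at x)"
    using DERIV_cmult[OF has_gradient_chain[OF \<phi>[unfolded k] DERIV_ident
          kappa_has_derivative(1)[OF cone k]], of a]
    by (simp add: k)
qed

lemma cone_D3:
  assumes cone: "cone x u v" and k: "k = kappa x u v"
    and a: "(a has_real_derivative a') (at u)" and \<phi>: "(\<phi> has_real_derivative b) (at k)"
    and f: "\<And>u. cone x u v \<Longrightarrow> f x y u v = a u * \<phi> (kappa x u v)"
  shows "D3 f x y u v = a' * \<phi> k + a u * (b * kappa_u x k u v)"
proof (rule D3_eqI[OF eventually_mono[OF eventually_cone(2)[OF cone]]])
  show "f x y s v = a s * \<phi> (kappa x s v)" if "cone x s v" for s using f[OF that] .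
  show "((\<lambda>s. a s * \<phi> (kappa x s v)) has_real_derivative
      a' * \<phi> k + a u * (b * kappa_u x k u v)) (at u)"
    using DERIV_mult'[OF a DERIV_chain2[OF \<phi>[unfolded k] kappa_has_derivative(2)[OF cone k]]]
    by (simp add: k add.commute)
qed

lemma cone_D4:
  assumes cone: "cone x u v" and k: "k = kappa x u v"
    and a: "(a has_real_derivative a') (at v)" and \<phi>: "(\<phi> has_real_derivative b) (at k)"
    and f: "\<And>v. cone x u v \<Longrightarrow> f x y u v = a v * \<phi> (kappa x u v)"
  shows "D4 f x y u v = a' * \<phi> k + a v * (b * kappa_v x k v)"
proof (rule D4_eqI[OF eventually_mono[OF eventually_cone(3)[OF cone]]])
  show "f x y u s = a s * \<phi> (kappa x u s)" if "cone x u s" for s using f[OF that] .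
  show "((\<lambda>s. a s * \<phi> (kappa x u s)) has_real_derivative
      a' * \<phi> k + a v * (b * kappa_v x k v)) (at v)"
    using DERIV_mult'[OF a DERIV_chain2[OF \<phi>[unfolded k] kappa_has_derivative(3)[OF cone k]]]
    by (simp add: k add.commute)
qed

definition dual_profile :: "real \<Rightarrow> real \<Rightarrow> real" where
  "dual_profile x k = m x k / (4 * (axial x k)\<^sup>2)"

lemma dual_profile_has_gradient:
  assumes "(x, k) \<in> M"
  shows "(dual_profile has_gradient
    ((m_x x k * axial x k - 2 * m x k * (m_x x k - k * m_kx x k)) / (4 * axial x k ^ 3),
     hess x k / (4 * axial x k ^ 3))) (x, k)"
proof -
  have a: "axial x k > 0" using assms by (rule axial_pos)
  then have "4 * (axial x k)\<^sup>2 \<noteq> 0" by simp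
  from has_gradient_divide[OF m_has_gradient[OF assms]
      has_gradient_cmult[OF has_gradient_power2[OF axial_has_gradient[OF assms]], of 4] this]
  show ?thesis
    unfolding dual_profile_def
    by (rule has_gradient_eq_rhs)
      (use a in \<open>simp_all add: hess_def field_simps power2_eq_square power3_eq_cube\<close>)
qed

lemma inverse_m_k_has_gradient:
  assumes "(x, k) \<in> M"
  shows "((\<lambda>x k. 1 / (2 * m_k x k)) has_gradient
    (- m_kx x k / (2 * (m_k x k)\<^sup>2), - m_kk x k / (2 * (m_k x k)\<^sup>2))) (x, k)"
  using m_k_has_gradient[OF assms] m_k_pos[OF assms] unfolding has_gradient_def
  by (auto intro!: derivative_eq_intros simp: fun_eq_iff field_simps power2_eq_square)

lemma inverse_axial_has_gradient:
  assumes "(x, k) \<in> M"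
  shows "((\<lambda>x k. 1 / (2 * axial x k)) has_gradient
    (- (m_x x k - k * m_kx x k) / (2 * (axial x k)\<^sup>2), k * m_kk x k / (2 * (axial x k)\<^sup>2))) (x, k)"
  using axial_has_gradient[OF assms] axial_pos[OF assms] unfolding has_gradient_def
  by (auto intro!: derivative_eq_intros simp: fun_eq_iff field_simps power2_eq_square)

definition spray_x_profile :: "real \<Rightarrow> real \<Rightarrow> real" where
  "spray_x_profile x k =
    ((m_k x k + 2 * k * m_kk x k) * m_x x k - 2 * k * m_k x k * m_kx x k) / (4 * (axial x k)\<^sup>2)"

definition spray_y_profile :: "real \<Rightarrow> real \<Rightarrow> real" where
  "spray_y_profile x k =
    - (m_x x k * (m_k x k + k * m_kk x k) - k * m_k x k * m_kx x k) / (2 * axial x k * m_k x k)"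

lemma cone_equator:
  assumes "(x, 0) \<in> M" "v > 0"
  shows "cone x 0 v"
  using assms by (force simp: cone_def slope_map_def slope_def)

lemma kappa_equator:
  assumes "cone x 0 v"
  shows "kappa x 0 v = 0"
  using cone_square_eq[OF assms refl] cone_profile_pos[OF assms refl] by simp

lemma profile_pos_equator:
  assumes "(x, 0) \<in> M"
  shows "m x 0 > 0" "m_k x 0 > 0"
  using axial_pos[OF assms] m_k_pos[OF assms] by (simp_all add: axial_def)

lemma isCont_profile_equator:
  assumes "(x, 0) \<in> M"
  shows "isCont (m x) 0" "isCont (m_k x) 0"
  using has_gradient_partial2 m_has_gradient[OF assms] m_k_has_gradient[OF assms] DERIV_isCont by blast+

lemma spray_x_profile_C1:
  assumes S: "S \<subseteq> {k. (x, k) \<in> M}"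
    and C1: "m_x x C1_differentiable_on S" "m_kx x C1_differentiable_on S" "m_kk x C1_differentiable_on S"
  shows "spray_x_profile x C1_differentiable_on S"
proof -
  have m_k: "m_k x C1_differentiable_on S"
    using S has_gradient_partial2[OF m_k_has_gradient]
    by (intro C1_differentiable_on_realI[OF _ C1_differentiable_imp_continuous_on[OF C1(3)]]) auto
  have "m x C1_differentiable_on S"
    using S has_gradient_partial2[OF m_has_gradient]
    by (intro C1_differentiable_on_realI[OF _ C1_differentiable_imp_continuous_on[OF m_k]]) auto
  moreover have "axial x k \<noteq> 0" if "k \<in> S" for k
    using S that axial_pos[of x k] by auto
  ultimately show ?thesis
    using m_k C1 unfolding spray_x_profile_def axial_def
    by (intro derivative_intros) auto
qed

lemma spray_x_profile_DERIV_0: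
  assumes M: "(x, 0) \<in> M" and m_x: "(m_x x has_real_derivative m_kx x 0) (at 0)"
    and cont: "isCont (m_kx x) 0" "isCont (m_kk x) 0"
  shows "(spray_x_profile x has_real_derivative
    (3 * m_kk x 0 * m_x x 0 - m_k x 0 * m_kx x 0) / (4 * (m x 0)\<^sup>2)) (at 0)"
proof -
  note pos = profile_pos_equator[OF M]
  have m_k: "(m_k x has_real_derivative m_kk x 0) (at 0)"
    using has_gradient_partial2[OF m_k_has_gradient[OF M]] .
  have axial: "(axial x has_real_derivative 0) (at 0)"
    using has_gradient_partial2[OF axial_has_gradient[OF M]] by simp
  have k_m_kk: "((\<lambda>k. k * m_kk x k) has_real_derivative m_kk x 0) (at 0)"
    and k_m_kx: "((\<lambda>k. k * m_kx x k) has_real_derivative m_kx x 0) (at 0)"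
    using cont by (auto intro!: DERIV_ident_mult_at_0)
  note numerator = DERIV_diff[OF DERIV_mult[OF DERIV_add[OF m_k DERIV_cmult[OF k_m_kk, of 2]] m_x]
      DERIV_mult[OF DERIV_cmult[OF m_k, of 2] k_m_kx]]
    and denominator = DERIV_cmult[OF DERIV_power[OF axial, of 2], of 4]
  have "((\<lambda>k. ((m_k x k + 2 * (k * m_kk x k)) * m_x x k - 2 * m_k x k * (k * m_kx x k))
      / (4 * (axial x k)\<^sup>2)) has_real_derivative
      (3 * m_kk x 0 * m_x x 0 - m_k x 0 * m_kx x 0) / (4 * (m x 0)\<^sup>2)) (at 0)"
    by (rule DERIV_cong[OF DERIV_divide[OF numerator denominator]])
      (use pos in \<open>simp_all add: axial_def field_simps\<close>)
  then show ?thesis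
    by (simp add: spray_x_profile_def[abs_def] mult_ac)
qed

lemma spray_x_profile_equator_DERIV:
  assumes M: "(x, 0) \<in> M" and m_x: "((\<lambda>s. m_x s 0) has_real_derivative m_xx) (at x)"
  shows "((\<lambda>s. spray_x_profile s 0) has_real_derivative
    ((m_kx x 0 * m_x x 0 + m_k x 0 * m_xx) * m x 0 - 2 * m_k x 0 * (m_x x 0)\<^sup>2) / (4 * m x 0 ^ 3)) (at x)"
proof -
  note pos = profile_pos_equator[OF M]
  have "((\<lambda>s. m_k s 0 * m_x s 0 / (4 * (m s 0)\<^sup>2)) has_real_derivative
    ((m_kx x 0 * m_x x 0 + m_k x 0 * m_xx) * m x 0 - 2 * m_k x 0 * (m_x x 0)\<^sup>2) / (4 * m x 0 ^ 3)) (at x)"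
    using pos by (auto intro!: derivative_eq_intros m_x has_gradient_partial1[OF m_has_gradient[OF M]]
        has_gradient_partial1[OF m_k_has_gradient[OF M]] simp: field_simps power2_eq_square power3_eq_cube)
  then show ?thesis by (simp add: spray_x_profile_def axial_def)
qed

lemma eventually_kappa_equator:
  assumes M: "(x, 0) \<in> M" and v: "v > 0" and S: "open S" "0 \<in> S"
  shows "\<forall>\<^sub>F u in nhds 0. cone x u v \<and> kappa x u v \<in> S"
proof -
  note cone = cone_equator[OF M v]
  have "isCont (\<lambda>u. kappa x u v) 0"
    using kappa_has_derivative(2)[OF cone refl] by (rule DERIV_isCont)
  then have "((\<lambda>u. kappa x u v) \<longlongrightarrow> 0) (nhds 0)"
    by (simp add: isCont_def tendsto_nhds_iff kappa_equator[OF cone])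
  from eventually_conj[OF eventually_cone(2)[OF cone] topological_tendstoD[OF this S]]
  show ?thesis .
qed

lemma isCont_kappa_equator:
  fixes \<phi> :: "real \<Rightarrow> real"
  assumes M: "(x, 0) \<in> M" and v: "v > 0" and \<phi>: "isCont \<phi> 0"
  shows "isCont (\<lambda>u. \<phi> (kappa x u v)) 0"
  using isCont_o2[OF DERIV_isCont[OF kappa_has_derivative(2)[OF cone_equator[OF M v] refl]], of \<phi>] \<phi>
  by (simp add: kappa_equator[OF cone_equator[OF M v]])

lemma fibre_derivatives_of_profile:
  assumes E: "\<And>r t. t > 0 \<Longrightarrow> (x, r\<^sup>2 / t\<^sup>2) \<in> M \<Longrightarrow> E x y r t = t\<^sup>2 * m x (r\<^sup>2 / t\<^sup>2)"
    and t: "t > 0" and M: "(x, r\<^sup>2 / t\<^sup>2) \<in> M"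
  shows "D3 E x y r t = 2 * r * m_k x (r\<^sup>2 / t\<^sup>2)" and "D4 E x y r t = 2 * t * axial x (r\<^sup>2 / t\<^sup>2)"
proof -
  note m = has_gradient_partial2[OF m_has_gradient[OF M]]
  have "((\<lambda>s. (x, s\<^sup>2 / t\<^sup>2)) \<longlongrightarrow> (x, r\<^sup>2 / t\<^sup>2)) (nhds r)"
       "((\<lambda>s. (x, r\<^sup>2 / s\<^sup>2)) \<longlongrightarrow> (x, r\<^sup>2 / t\<^sup>2)) (nhds t)"
    using t by (auto intro!: tendsto_intros filterlim_ident)
  note ev = this[THEN topological_tendstoD, OF open_M M]
  have "((\<lambda>s. s\<^sup>2 / t\<^sup>2) has_real_derivative 2 * r / t\<^sup>2) (at r)"
    by (rule DERIV_cdivide) (auto intro!: derivative_eq_intros)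
  from DERIV_cmult[OF DERIV_chain2[OF m this], of "t\<^sup>2"]
  have "((\<lambda>s. t\<^sup>2 * m x (s\<^sup>2 / t\<^sup>2)) has_real_derivative 2 * r * m_k x (r\<^sup>2 / t\<^sup>2)) (at r)"
    using t by (simp add: mult_ac)
  then show "D3 E x y r t = 2 * r * m_k x (r\<^sup>2 / t\<^sup>2)"
    by (rule D3_eqI[OF eventually_mono[OF ev(1)], rotated]) (rule E[OF t])
  have "((\<lambda>s. r\<^sup>2 / s\<^sup>2) has_real_derivative - 2 * r\<^sup>2 / t ^ 3) (at t)"
    using t by (auto intro!: derivative_eq_intros simp: field_simps numeral_eq_Suc)
  from DERIV_mult[OF DERIV_power[OF DERIV_ident, of 2] DERIV_chain2[OF m this]]
  have "((\<lambda>s. s\<^sup>2 * m x (r\<^sup>2 / s\<^sup>2)) has_real_derivative 2 * t * axial x (r\<^sup>2 / t\<^sup>2)) (at t)"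
    by (rule DERIV_cong) (use t in \<open>simp add: axial_def field_simps power2_eq_square power3_eq_cube\<close>)
  moreover have "\<forall>\<^sub>F s in nhds t. E x y r s = s\<^sup>2 * m x (r\<^sup>2 / s\<^sup>2)"
    using ev(2) order_tendstoD(1)[OF filterlim_ident t] by eventually_elim (rule E)
  ultimately show "D4 E x y r t = 2 * t * axial x (r\<^sup>2 / t\<^sup>2)"
    by (rule D4_eqI[rotated])
qed

end

locale profile_lagrangian = even_profile +
  fixes L :: rf4
  assumes L_eq: "cone x u v \<Longrightarrow> L x y u v = v\<^sup>2 * dual_profile x (kappa x u v)"
begin

lemma D1_L:
  assumes cone: "cone x u v" and k: "k = kappa x u v"
  shows "D1 L x y u v = - (v\<^sup>2 * m_x x k / (4 * (axial x k)\<^sup>2))"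
proof -
  note pos = cone_profile_pos[OF cone k]
  have "D1 L x y u v = v\<^sup>2 *
      ((m_x x k * axial x k - 2 * m x k * (m_x x k - k * m_kx x k)) / (4 * axial x k ^ 3)
      + hess x k / (4 * axial x k ^ 3) * kappa_x x k)"
    by (rule cone_D1[OF cone k dual_profile_has_gradient[OF slope_map_kappa(1)[OF cone, folded k]]])
      (rule L_eq)
  also have "\<dots> = v\<^sup>2 * (m_x x k * (axial x k - 2 * (m x k - k * m_k x k))) / (4 * axial x k ^ 3)"
    using pos by (simp add: kappa_x_def field_simps)
  also have "\<dots> = - (v\<^sup>2 * m_x x k / (4 * (axial x k)\<^sup>2))"
    using pos by (simp add: axial_def[symmetric] power2_eq_square power3_eq_cube)
  finally show ?thesis .
qed

lemma D2_L:
  assumes "cone x u v"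
  shows "D2 L x y u v = 0"
  by (rule D2_eqI[where g = "\<lambda>_. v\<^sup>2 * dual_profile x (kappa x u v)"]) (simp_all add: L_eq[OF assms])

lemma D3_L:
  assumes cone: "cone x u v" and k: "k = kappa x u v"
  shows "D3 L x y u v = u * (1 / (2 * m_k x k))"
proof -
  note gradient = dual_profile_has_gradient[OF slope_map_kappa(1)[OF cone, folded k]]
  have "D3 L x y u v = 0 * dual_profile x k + v\<^sup>2 * (hess x k / (4 * axial x k ^ 3) * kappa_u x k u v)"
    by (rule cone_D3[OF cone k DERIV_const has_gradient_partial2[OF gradient]]) (rule L_eq)
  then show ?thesis
    using cone_profile_pos[OF cone k] by (simp add: kappa_u_def)
qed

lemma D4_L:
  assumes cone: "cone x u v" and k: "k = kappa x u v"
  shows "D4 L x y u v = v * (1 / (2 * axial x k))"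
proof -
  note gradient = dual_profile_has_gradient[OF slope_map_kappa(1)[OF cone, folded k]]
  have "D4 L x y u v = 2 * v * dual_profile x k + v\<^sup>2 * (hess x k / (4 * axial x k ^ 3) * kappa_v x k v)"
    by (rule cone_D4[OF cone k _ has_gradient_partial2[OF gradient]])
      (auto intro!: derivative_eq_intros L_eq)
  then show ?thesis
    using cone_profile_pos[OF cone k]
    by (simp add: kappa_v_def dual_profile_def m_eq_axial[of x k] field_simps power2_eq_square
        power3_eq_cube)
qed

lemma D2_D3_L:
  assumes "cone x u v"
  shows "D2 (D3 L) x y u v = 0"
  by (rule D2_eqI[where g = "\<lambda>_. u * (1 / (2 * m_k x (kappa x u v)))"])
    (simp_all add: D3_L[OF assms refl])

lemma D3_D3_L:
  assumes cone: "cone x u v" and k: "k = kappa x u v"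
  shows "D3 (D3 L) x y u v = (axial x k + 2 * k\<^sup>2 * m_kk x k) / (2 * hess x k)"
proof -
  note pos = cone_profile_pos[OF cone k]
    and gradient = inverse_m_k_has_gradient[OF slope_map_kappa(1)[OF cone, folded k]]
  have "D3 (D3 L) x y u v = 1 * (1 / (2 * m_k x k))
      + u * (- m_kk x k / (2 * (m_k x k)\<^sup>2) * kappa_u x k u v)"
    by (rule cone_D3[OF cone k DERIV_ident has_gradient_partial2[OF gradient]]) (rule D3_L[OF _ refl])
  also have "\<dots> = 1 / (2 * m_k x k) - u\<^sup>2 * (m_kk x k * axial x k ^ 3 / (v\<^sup>2 * m_k x k ^ 3 * hess x k))"
    by (simp add: kappa_u_def power2_eq_square power3_eq_cube mult_ac)
  also have "\<dots> = (hess x k - 2 * k * m_kk x k * axial x k) / (2 * m_k x k * hess x k)"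
    unfolding cone_square_eq[OF cone k] using pos by (simp add: field_simps power2_eq_square power3_eq_cube)
  also have "hess x k - 2 * k * m_kk x k * axial x k = m_k x k * (axial x k + 2 * k\<^sup>2 * m_kk x k)"
    by (simp add: hess_def m_eq_axial[of x k] algebra_simps power2_eq_square)
  finally show ?thesis using pos by simp
qed

lemma D4_D4_L:
  assumes cone: "cone x u v" and k: "k = kappa x u v"
  shows "D4 (D4 L) x y u v = (m_k x k + 2 * k * m_kk x k) / (2 * hess x k)"
proof -
  note pos = cone_profile_pos[OF cone k]
    and gradient = inverse_axial_has_gradient[OF slope_map_kappa(1)[OF cone, folded k]]
  have "D4 (D4 L) x y u v = 1 * (1 / (2 * axial x k))
      + v * (k * m_kk x k / (2 * (axial x k)\<^sup>2) * kappa_v x k v)"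
    by (rule cone_D4[OF cone k DERIV_ident has_gradient_partial2[OF gradient]]) (rule D4_L[OF _ refl])
  also have "\<dots> = (hess x k - 2 * k\<^sup>2 * m_k x k * m_kk x k) / (2 * axial x k * hess x k)"
    using pos by (simp add: kappa_v_def field_simps power2_eq_square)
  also have "hess x k - 2 * k\<^sup>2 * m_k x k * m_kk x k = axial x k * (m_k x k + 2 * k * m_kk x k)"
    by (simp add: hess_def m_eq_axial[of x k] algebra_simps power2_eq_square)
  finally show ?thesis using pos by simp
qed

lemma D4_D3_L:
  assumes cone: "cone x u v" and k: "k = kappa x u v"
  shows "D4 (D3 L) x y u v = u / v * (k * m_kk x k * axial x k / (m_k x k * hess x k))"
proof -
  note gradient = inverse_m_k_has_gradient[OF slope_map_kappa(1)[OF cone, folded k]]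
  have "D4 (D3 L) x y u v = 0 * (1 / (2 * m_k x k))
      + u * (- m_kk x k / (2 * (m_k x k)\<^sup>2) * kappa_v x k v)"
    by (rule cone_D4[OF cone k DERIV_const has_gradient_partial2[OF gradient]]) (rule D3_L[OF _ refl])
  then show ?thesis
    using cone_profile_pos[OF cone k] by (simp add: kappa_v_def power2_eq_square mult_ac)
qed

lemma D3_D4_L:
  assumes cone: "cone x u v" and k: "k = kappa x u v"
  shows "D3 (D4 L) x y u v = u / v * (k * m_kk x k * axial x k / (m_k x k * hess x k))"
proof -
  note gradient = inverse_axial_has_gradient[OF slope_map_kappa(1)[OF cone, folded k]]
  have "D3 (D4 L) x y u v = 0 * (1 / (2 * axial x k))
      + v * (k * m_kk x k / (2 * (axial x k)\<^sup>2) * kappa_u x k u v)"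
    by (rule cone_D3[OF cone k DERIV_const has_gradient_partial2[OF gradient]]) (rule D4_L[OF _ refl])
  then show ?thesis
    using cone_profile_pos[OF cone k]
    by (simp add: kappa_u_def power2_eq_square power3_eq_cube mult_ac)
qed

lemma D1_D4_L:
  assumes cone: "cone x u v" and k: "k = kappa x u v"
  shows "D1 (D4 L) x y u v = - v * ((m_x x k * (m_k x k + 2 * k * m_kk x k) - k * m_k x k * m_kx x k)
      / (2 * axial x k * hess x k))"
proof -
  note pos = cone_profile_pos[OF cone k]
    and gradient = inverse_axial_has_gradient[OF slope_map_kappa(1)[OF cone, folded k]]
  have "D1 (D4 L) x y u v = v * (- (m_x x k - k * m_kx x k) / (2 * (axial x k)\<^sup>2)
      + k * m_kk x k / (2 * (axial x k)\<^sup>2) * kappa_x x k)"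
    by (rule cone_D1[OF cone k gradient]) (rule D4_L[OF _ refl])
  also have "\<dots> = - v * ((m_x x k - k * m_kx x k) * hess x k
      + 2 * k\<^sup>2 * m_kk x k * (m x k * m_kx x k - m_k x k * m_x x k)) / (2 * (axial x k)\<^sup>2 * hess x k)"
    using pos by (simp add: kappa_x_def field_simps power2_eq_square)
  also have "(m_x x k - k * m_kx x k) * hess x k
      + 2 * k\<^sup>2 * m_kk x k * (m x k * m_kx x k - m_k x k * m_x x k)
    = axial x k * (m_x x k * (m_k x k + 2 * k * m_kk x k) - k * m_k x k * m_kx x k)"
    by (simp add: hess_def m_eq_axial[of x k] algebra_simps power2_eq_square)
  finally show ?thesis using pos by (simp add: power2_eq_square)
qed

lemmas L_derivatives = D1_L[OF _ refl] D2_L D3_L[OF _ refl] D4_L[OF _ refl] D2_D3_L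
  D3_D3_L[OF _ refl] D4_D4_L[OF _ refl] D4_D3_L[OF _ refl] D3_D4_L[OF _ refl] D1_D4_L[OF _ refl]

lemma fibre_hessian_L:
  assumes cone: "cone x u v"
  shows "fibre_hessian L x y u v = 1 / (4 * hess x (kappa x u v))"
proof -
  define k where "k = kappa x u v"
  note pos = cone_profile_pos[OF cone k_def]
  have ratio: "(u / v)\<^sup>2 = k * (m_k x k)\<^sup>2 / (axial x k)\<^sup>2"
    unfolding power_divide cone_square_eq[OF cone k_def] using pos by simp
  have mixed: "(u / v * (k * m_kk x k * axial x k / (m_k x k * hess x k)))\<^sup>2 =
      k * (k * m_kk x k / hess x k)\<^sup>2"
    unfolding power_mult_distrib ratio using pos by (simp add: field_simps power2_eq_square)
  have "fibre_hessian L x y u v =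
      ((axial x k + 2 * k\<^sup>2 * m_kk x k) * (m_k x k + 2 * k * m_kk x k) - 4 * k * (k * m_kk x k)\<^sup>2)
      / (4 * (hess x k)\<^sup>2)"
    unfolding fibre_hessian_def L_derivatives[OF cone, folded k_def] mixed
    using pos by (simp add: field_simps power2_eq_square)
  also have "(axial x k + 2 * k\<^sup>2 * m_kk x k) * (m_k x k + 2 * k * m_kk x k) - 4 * k * (k * m_kk x k)\<^sup>2
      = hess x k"
    by (simp add: hess_def m_eq_axial[of x k] algebra_simps power2_eq_square power3_eq_cube)
  finally show ?thesis using pos by (simp add: k_def power2_eq_square)
qed

lemma spray_x_L:
  assumes cone: "cone x u v"
  shows "spray_x L x y u v = v\<^sup>2 * spray_x_profile x (kappa x u v)"
  unfolding spray_x_def spray_x_profile_def fibre_hessian_L[OF cone] L_derivatives[OF cone]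
  using cone_profile_pos[OF cone refl] by (simp add: field_simps power2_eq_square)

lemma spray_y_L:
  assumes cone: "cone x u v"
  shows "spray_y L x y u v = u * v * spray_y_profile x (kappa x u v)"
  unfolding spray_y_def spray_y_profile_def fibre_hessian_L[OF cone] L_derivatives[OF cone]
  using cone_profile_pos[OF cone refl] by (simp add: field_simps power2_eq_square)

text \<open>\<open>G\<^sub>u\<close> is \<open>u\<close> times a function that is merely continuous; its derivative at \<open>u = 0\<close> is the value of
  that function.\<close>

lemma D3_D3_spray_x_equator:
  assumes M: "(x, 0) \<in> M" and v: "v > 0" and S: "open S" "0 \<in> S"
    and C1: "spray_x_profile x C1_differentiable_on S" and cont: "isCont (m_kk x) 0"
    and Z_k: "(spray_x_profile x has_real_derivative Z_k) (at 0)"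
  shows "D3 (D3 (spray_x L)) x y 0 v = 2 * Z_k * (m x 0 / m_k x 0)\<^sup>2"
proof -
  obtain Z' where Z': "\<And>k. k \<in> S \<Longrightarrow> (spray_x_profile x has_real_derivative Z' k) (at k)"
    and contZ': "continuous_on S Z'"
    using C1 by (rule C1_differentiable_on_realE) blast
  have Z'_0: "Z' 0 = Z_k" using DERIV_unique[OF Z'[OF S(2)] Z_k] .
  define \<psi> where "\<psi> = (\<lambda>k. 2 * Z' k * axial x k ^ 3 / (m_k x k * hess x k))"
  have D3: "D3 (spray_x L) x y u v = u * \<psi> (kappa x u v)" if "cone x u v \<and> kappa x u v \<in> S" for u
  proof -
    have "D3 (spray_x L) x y u v = 0 * spray_x_profile x (kappa x u v) + v\<^sup>2 * (Z' (kappa x u v) *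
        kappa_u x (kappa x u v) u v)"
      using that by (intro cone_D3[OF _ refl DERIV_const Z'] spray_x_L) auto
    then show ?thesis using v by (simp add: \<psi>_def kappa_u_def)
  qed
  note pos = profile_pos_equator[OF M]
  have "isCont Z' 0" using contZ' S by (simp add: continuous_on_eq_continuous_at)
  then have "isCont \<psi> 0"
    unfolding \<psi>_def hess_def axial_def using pos
    by (intro continuous_intros isCont_profile_equator[OF M] cont) auto
  note DERIV_ident_mult_at_0[OF isCont_kappa_equator[OF M v this]]
  then have "D3 (D3 (spray_x L)) x y 0 v = \<psi> (kappa x 0 v)"
    by (rule D3_eqI[OF eventually_mono[OF eventually_kappa_equator[OF M v S]], rotated]) (rule D3)
  also have "\<dots> = 2 * Z_k * (m x 0 / m_k x 0)\<^sup>2"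
    using pos by (simp add: kappa_equator[OF cone_equator[OF M v]] \<psi>_def Z'_0 hess_def axial_def
        power2_eq_square power3_eq_cube)
  finally show ?thesis .
qed

lemma spray_x_derivatives_equator:
  assumes M: "(x, 0) \<in> M" and v: "v > 0"
    and Z_x: "((\<lambda>s. spray_x_profile s 0) has_real_derivative Z_x) (at x)"
    and Z_k: "(spray_x_profile x has_real_derivative Z_k) (at 0)"
  shows "D4 (D1 (spray_x L)) x y 0 v = 2 * v * Z_x"
    and "D3 (D2 (spray_x L)) x y 0 v = 0"
    and "D3 (spray_x L) x y 0 v = 0"
    and "D4 (spray_x L) x y 0 v = 2 * v * spray_x_profile x 0"
proof -
  note cone = cone_equator[OF M v]
  have G: "spray_x L x y 0 v = v\<^sup>2 * spray_x_profile x 0" if "cone x 0 v" for x v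
    using spray_x_L[OF that] by (simp add: kappa_equator[OF that])
  have "D1 (spray_x L) x y 0 s = s\<^sup>2 * Z_x" if "cone x 0 s" for s
    by (rule D1_eqI[OF eventually_mono[OF eventually_cone(1)[OF that]] DERIV_cmult[OF Z_x]]) (rule G)
  then show "D4 (D1 (spray_x L)) x y 0 v = 2 * v * Z_x"
    by (intro D4_eqI[OF eventually_mono[OF eventually_cone(3)[OF cone]]])
      (auto intro!: derivative_eq_intros)
  have "D2 (spray_x L) x y u v = 0" if "cone x u v" for u
    by (rule D2_eqI[where g = "\<lambda>_. v\<^sup>2 * spray_x_profile x (kappa x u v)"])
      (simp_all add: spray_x_L[OF that])
  then show "D3 (D2 (spray_x L)) x y 0 v = 0"
    by (intro D3_eqI[OF eventually_mono[OF eventually_cone(2)[OF cone]] DERIV_const]) auto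
  have "D3 (spray_x L) x y 0 v = 0 * spray_x_profile x 0
      + v\<^sup>2 * (Z_k * kappa_u x 0 0 v)"
    by (rule cone_D3[OF cone kappa_equator[OF cone, symmetric] DERIV_const Z_k]) (rule spray_x_L)
  then show "D3 (spray_x L) x y 0 v = 0" by (simp add: kappa_u_def)
  show "D4 (spray_x L) x y 0 v = 2 * v * spray_x_profile x 0"
    by (rule D4_eqI[where g = "\<lambda>s. s\<^sup>2 * spray_x_profile x 0",
          OF eventually_mono[OF eventually_cone(3)[OF cone]]])
      (auto intro!: derivative_eq_intros simp: G)
qed

lemma D3_spray_y_equator:
  assumes M: "(x, 0) \<in> M" and v: "v > 0"
    and cont: "isCont (m_x x) 0" "isCont (m_kx x) 0" "isCont (m_kk x) 0"
  shows "D3 (spray_y L) x y 0 v = - v * m_x x 0 / (2 * m x 0)"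
proof -
  note cone = cone_equator[OF M v]
  note pos = profile_pos_equator[OF M]
  have "isCont (spray_y_profile x) 0"
    unfolding spray_y_profile_def axial_def
    using pos by (intro continuous_intros isCont_profile_equator[OF M] cont) auto
  then have "isCont (\<lambda>k. v * spray_y_profile x k) 0" by (intro continuous_intros)
  note DERIV_ident_mult_at_0[OF isCont_kappa_equator[OF M v this]]
  then have "D3 (spray_y L) x y 0 v = v * spray_y_profile x (kappa x 0 v)"
    by (rule D3_eqI[OF eventually_mono[OF eventually_cone(2)[OF cone]], rotated])
      (simp add: spray_y_L mult_ac)
  then show ?thesis
    using pos by (simp add: kappa_equator[OF cone] spray_y_profile_def axial_def)
qed

theorem flag_curvature_equator:
  assumes M: "(x, 0) \<in> M" and v: "v > 0" and S: "open S" "0 \<in> S"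
    and C1: "m_x x C1_differentiable_on S" "m_kx x C1_differentiable_on S" "m_kk x C1_differentiable_on S"
    and m_xk: "(m_x x has_real_derivative m_kx x 0) (at 0)"
    and m_xx: "((\<lambda>s. m_x s 0) has_real_derivative m_xx) (at x)"
  shows "flag_curvature L x y 0 v = m_k x 0 * m_xx / m x 0 + m_x x 0 * m_kx x 0 / (2 * m x 0)
    - 3 * m_k x 0 * (m_x x 0)\<^sup>2 / (2 * (m x 0)\<^sup>2) + 3 * (m_x x 0)\<^sup>2 * m_kk x 0 / (2 * m x 0 * m_k x 0)"
proof -
  note cone = cone_equator[OF M v]
  note pos = profile_pos_equator[OF M]
  have cont: "isCont (m_x x) 0" "isCont (m_kx x) 0" "isCont (m_kk x) 0"
    using C1[THEN C1_differentiable_imp_continuous_on] S by (simp_all add: continuous_on_eq_continuous_at)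
  note Z_k = spray_x_profile_DERIV_0[OF M m_xk cont(2,3)]
    and Z_x = spray_x_profile_equator_DERIV[OF M m_xx]
  define S' where "S' = S \<inter> Pair x -` M"
  have S': "open S'" "0 \<in> S'" "S' \<subseteq> {k. (x, k) \<in> M}"
    using S M open_M by (auto simp: S'_def intro!: open_Int open_vimage continuous_intros)
  have "spray_x_profile x C1_differentiable_on S'"
    using C1 by (intro spray_x_profile_C1[OF S'(3)] C1_differentiable_on_subset[of _ S S'])
      (auto simp: S'_def)
  note D3_D3_G = D3_D3_spray_x_equator[OF M v S'(1,2) this cont(3) Z_k]
  have spray_values: "spray_x L x y 0 v = v\<^sup>2 * spray_x_profile x 0" "spray_y L x y 0 v = 0"
    using spray_x_L[OF cone] spray_y_L[OF cone] by (simp_all add: kappa_equator[OF cone])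
  have D4L: "D4 L x y 0 v = v / (2 * m x 0)"
    using D4_L[OF cone refl] by (simp add: kappa_equator[OF cone] axial_def)
  show ?thesis
    unfolding flag_curvature_def Let_def D3_D3_G spray_x_derivatives_equator[OF M v Z_x Z_k]
      D3_spray_y_equator[OF M v cont] spray_values D4L
    using pos v by (simp add: spray_x_profile_def axial_def field_simps power2_eq_square power3_eq_cube)
qed

end

lemma (in even_profile) profile_lagrangian_fibre_legendre:
  assumes E: "\<And>x y r t. t > 0 \<Longrightarrow> (x, r\<^sup>2 / t\<^sup>2) \<in> M \<Longrightarrow> E x y r t = t\<^sup>2 * m x (r\<^sup>2 / t\<^sup>2)"
    and inj: "\<And>x y k. (x, k) \<in> M \<Longrightarrow> inj (\<lambda>p. (D3 E x y (fst p) (snd p), D4 E x y (fst p) (snd p)))"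
  shows "profile_lagrangian M m m_x m_k m_kx m_kk (fibre_legendre E)"
proof
  fix x y u v assume cone: "cone x u v"
  define k where "k = kappa x u v"
  define r where "r = u / (2 * m_k x k)"
  define t where "t = v / (2 * axial x k)"
  note M = slope_map_kappa(1)[OF cone, folded k_def] and square_eq = cone_square_eq[OF cone k_def]
    and pos = cone_profile_pos[OF cone k_def]
  have t: "t > 0" and rt: "r\<^sup>2 / t\<^sup>2 = k"
    using pos unfolding r_def t_def by (simp_all add: power_divide power_mult_distrib square_eq)
  have "D3 E x y r t = 2 * r * m_k x k" "D4 E x y r t = 2 * t * axial x k"
    using fibre_derivatives_of_profile[of x E y t r] E t M by (simp_all add: rt)
  then have D: "D3 E x y r t = u" "D4 E x y r t = v"
    using pos by (simp_all add: r_def t_def)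
  have "(THE p. D3 E x y (fst p) (snd p) = u \<and> D4 E x y (fst p) (snd p) = v) = (r, t)"
    using D injD[OF inj[OF M], of y _ "(r, t)"] by (intro the_equality) simp_all
  then have "fibre_legendre E x y u v = r * u + t * v - t\<^sup>2 * m x k"
    using E[OF t] M by (simp add: fibre_legendre_def rt)
  also have "\<dots> = u\<^sup>2 / (2 * m_k x k) + v\<^sup>2 / (2 * axial x k) - v\<^sup>2 * m x k / (4 * (axial x k)\<^sup>2)"
    by (simp add: r_def t_def power2_eq_square)
  also have "\<dots> = v\<^sup>2 * dual_profile x k"
    unfolding square_eq dual_profile_def m_eq_axial[of x k]
    using pos by (simp add: field_simps power2_eq_square)
  finally show "fibre_legendre E x y u v = v\<^sup>2 * dual_profile x (kappa x u v)"
    by (simp add: k_def)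
qed

lemma even_profile_near:
  assumes D: "open D" "(x0, 0) \<in> D"
    and m: "\<And>x k. (x, k) \<in> D \<Longrightarrow> (m has_gradient (m_x x k, m_k x k)) (x, k)"
    and m_k: "\<And>x k. (x, k) \<in> D \<Longrightarrow> (m_k has_gradient (m_kx x k, m_kk x k)) (x, k)"
    and m_kk: "continuous_on D (\<lambda>p. m_kk (fst p) (snd p))"
    and pos: "m x0 0 > 0" "m_k x0 0 > 0"
  obtains M :: "(real \<times> real) set" where "even_profile M m m_x m_k m_kx m_kk" "(x0, 0) \<in> M" "M \<subseteq> D"
proof -
  have cont: "continuous_on D (\<lambda>p. m (fst p) (snd p))" "continuous_on D (\<lambda>p. m_k (fst p) (snd p))"
    using m m_k D(1) unfolding has_gradient_def
    by (auto simp: continuous_on_eq_continuous_at intro!: has_derivative_continuous)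
  let ?at = "\<lambda>f p. f (fst p) (snd p)" and ?axial = "\<lambda>p. m (fst p) (snd p) - snd p * m_k (fst p) (snd p)"
  define P where "P = (\<lambda>p. min (?at m_k p) (min (?axial p)
    (?at m_k p * ?axial p + 2 * snd p * ?at m p * ?at m_kk p)))"
  have "continuous_on D P"
    unfolding P_def by (intro continuous_intros cont m_kk)
  then have "open (D \<inter> P -` {0<..})" using D(1) by (intro continuous_open_preimage) auto
  moreover have "(x0, 0) \<in> D \<inter> P -` {0<..}" using D(2) pos by (simp add: P_def)
  ultimately obtain I J where IJ: "open I" "open J" "x0 \<in> I" "0 \<in> J" "I \<times> J \<subseteq> D \<inter> P -` {0<..}"
    using open_prod_elim by (metis mem_Sigma_iff)
  obtain e where e: "e > 0" "ball (0::real) e \<subseteq> J" using IJ open_contains_ball by blast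
  define M where "M = I \<times> ball (0::real) e"
  have M: "M \<subseteq> D" "\<And>p. p \<in> M \<Longrightarrow> P p > 0" using IJ e unfolding M_def by blast+
  show ?thesis
  proof (rule that)
    show "(x0, 0) \<in> M" using IJ e by (simp add: M_def)
    show "even_profile M m m_x m_k m_kx m_kk"
    proof
      show "open M" unfolding M_def using IJ by (intro open_Times) auto
      have "{k. (x, k) \<in> M} = (if x \<in> I then ball 0 e else {})" for x by (auto simp: M_def)
      then show "is_interval {k. (x, k) \<in> M}" for x by (simp add: is_interval_ball_real)
    qed (use M m m_k in \<open>force simp: P_def\<close>)+
  qed (rule M)
qed

section \<open>The rotating Kepler problem\<close>

definition kepler_factor :: "real \<Rightarrow> real \<Rightarrow> real" where
  "kepler_factor c x = x\<^sup>2 + 2 * c"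

lemma kepler_factor_pos:
  assumes "c > 0"
  shows "kepler_factor c x > 0"
  using assms by (simp add: kepler_factor_def add_nonneg_pos)

lemma kepler_factor_square_gt:
  assumes "c > 3/2"
  shows "(kepler_factor c x)\<^sup>2 > 16 * x"
proof -
  have "(x\<^sup>2 + 3)\<^sup>2 - 16 * x = (x - 1)\<^sup>2 * ((x + 1)\<^sup>2 + 8)" by algebra
  then have "16 * x \<le> (x\<^sup>2 + 3)\<^sup>2" by (smt (verit) zero_le_mult_iff zero_le_power2)
  also have "\<dots> < (kepler_factor c x)\<^sup>2"
    using assms unfolding kepler_factor_def by (intro power_strict_mono) (auto simp: add_pos_nonneg)
  finally show ?thesis .
qed

definition kepler_drift :: "real \<Rightarrow> real \<Rightarrow> real \<times> real" where
  "kepler_drift c x = (0, 16 * x / (kepler_factor c x)\<^sup>2)"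

lemma norm_kepler_drift_less_1:
  assumes "c > 3/2" "x > 0"
  shows "norm (kepler_drift c x) < 1"
  using kepler_factor_square_gt[OF assms(1), of x] kepler_factor_pos[of c x] assms
  by (simp add: kepler_drift_def norm_Pair)

lemma Fstar_eq_tilted_norm:
  assumes "x > 0"
  shows "Fstar c x y r t = kepler_factor c x / 4 * tilted_norm (kepler_drift c x) (r, t / x)"
proof -
  define n where "n = norm (r, t / x)"
  have n: "sqrt (r\<^sup>2 + t\<^sup>2 / x\<^sup>2) = n"
    by (simp add: n_def norm_Pair power_divide)
  have "kepler_drift c x \<bullet> sgn (r, t / x) = 16 * t / (n * (kepler_factor c x)\<^sup>2)"
    using assms by (simp add: kepler_drift_def sgn_div_norm inverse_eq_divide flip: n_def)
  then show ?thesis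
    unfolding Fstar_def tilted_norm_def tilt_def n n_def[symmetric] by (simp add: kepler_factor_def)
qed

lemma Lstar_fibre_derivatives:
  assumes c: "c > 3/2" and x: "x > 0"
  defines "T \<equiv> \<lambda>r t. tilted_norm_legendre (kepler_drift c x) (r, t / x)"
  shows "D3 (Lstar c) x y r t = (kepler_factor c x)\<^sup>2 / 16 * fst (T r t)"
    and "D4 (Lstar c) x y r t = (kepler_factor c x)\<^sup>2 / 16 * (snd (T r t) / x)"
proof -
  define A a where "A = kepler_factor c x" and "a = kepler_drift c x"
  note folds = A_def[symmetric] a_def[symmetric]
  have a: "norm a < 1" unfolding a_def using c x by (rule norm_kepler_drift_less_1)
  have Lstar: "Lstar c x y r t = A\<^sup>2 / 16 * ((tilted_norm a (r, t / x))\<^sup>2 / 2)" for r t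
    unfolding Lstar_def Fstar_eq_tilted_norm[OF x] folds
    by (simp add: power_mult_distrib power_divide)
  have derivative: "((\<lambda>s. A\<^sup>2 / 16 * ((tilted_norm a (f s))\<^sup>2 / 2)) has_real_derivative
      A\<^sup>2 / 16 * (tilted_norm_legendre a (f s) \<bullet> h)) (at s)"
    if "(f has_vector_derivative h) (at s)" for f h s
    using has_derivative_compose[OF that[unfolded has_vector_derivative_def]
        tilted_norm_square_has_derivative[OF a]]
    by (intro DERIV_cmult) (simp add: has_field_derivative_def mult_commute_abs)
  have "((\<lambda>s. (s, t / x)) has_vector_derivative (1, 0)) (at r)"
    by (auto intro!: derivative_eq_intros)
  from derivative[OF this] show "D3 (Lstar c) x y r t = (kepler_factor c x)\<^sup>2 / 16 * fst (T r t)"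
    by (intro D3_eqI[OF always_eventually]) (simp_all add: Lstar inner_prod_def T_def folds)
  have "((\<lambda>s. (r, s / x)) has_vector_derivative (0, 1 / x)) (at t)"
    by (auto intro!: derivative_eq_intros)
  from derivative[OF this] show "D4 (Lstar c) x y r t = (kepler_factor c x)\<^sup>2 / 16 * (snd (T r t) / x)"
    by (intro D4_eqI[OF always_eventually]) (simp_all add: Lstar inner_prod_def T_def folds)
qed

lemma inj_Lstar_legendre:
  assumes c: "c > 3/2" and x: "x > 0"
  shows "inj (\<lambda>p. (D3 (Lstar c) x y (fst p) (snd p), D4 (Lstar c) x y (fst p) (snd p)))"
proof (rule injI)
  define T where "T = tilted_norm_legendre (kepler_drift c x)"
  have "inj T"
    unfolding T_def using c x by (intro inj_tilted_norm_legendre norm_kepler_drift_less_1)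
  fix p q
  assume "(D3 (Lstar c) x y (fst p) (snd p), D4 (Lstar c) x y (fst p) (snd p))
    = (D3 (Lstar c) x y (fst q) (snd q), D4 (Lstar c) x y (fst q) (snd q))"
  then have "T (fst p, snd p / x) = T (fst q, snd q / x)"
    using kepler_factor_pos[of c x] c x unfolding Lstar_fibre_derivatives[OF c x]
    by (simp add: T_def prod_eq_iff)
  from injD[OF \<open>inj T\<close> this] show "p = q"
    using x by (simp add: prod_eq_iff)
qed

definition kepler_sqnorm :: "real \<Rightarrow> real \<Rightarrow> real" where
  "kepler_sqnorm x k = k + 1 / x\<^sup>2"

definition kepler_tilt :: "real \<Rightarrow> real \<Rightarrow> real \<Rightarrow> real" where
  "kepler_tilt c x k = sqrt (1 - 16 / ((kepler_factor c x)\<^sup>2 * sqrt (kepler_sqnorm x k)))"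

definition kepler_tilt_x :: "real \<Rightarrow> real \<Rightarrow> real \<Rightarrow> real" where
  "kepler_tilt_x c x k = (1 - (kepler_tilt c x k)\<^sup>2) / (2 * kepler_tilt c x k)
    * (4 * x / kepler_factor c x - 1 / (x ^ 3 * kepler_sqnorm x k))"

definition kepler_tilt_k :: "real \<Rightarrow> real \<Rightarrow> real \<Rightarrow> real" where
  "kepler_tilt_k c x k = (1 - (kepler_tilt c x k)\<^sup>2) / (4 * kepler_tilt c x k * kepler_sqnorm x k)"

definition kepler_profile :: "real \<Rightarrow> real \<Rightarrow> real \<Rightarrow> real" where
  "kepler_profile c x k = (kepler_factor c x)\<^sup>2 * kepler_sqnorm x k * (1 + kepler_tilt c x k)\<^sup>2 / 32"

definition kepler_profile_x :: "real \<Rightarrow> real \<Rightarrow> real \<Rightarrow> real" where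
  "kepler_profile_x c x k = (1 + kepler_tilt c x k)\<^sup>2 * (4 * x * kepler_factor c x * kepler_sqnorm x k
    - (kepler_factor c x)\<^sup>2 * (1 + kepler_tilt c x k) / x ^ 3) / (32 * kepler_tilt c x k)"

definition kepler_profile_k :: "real \<Rightarrow> real \<Rightarrow> real \<Rightarrow> real" where
  "kepler_profile_k c x k = (kepler_factor c x)\<^sup>2 * (1 + kepler_tilt c x k) ^ 3 / (64 * kepler_tilt c x k)"

definition kepler_profile_kx :: "real \<Rightarrow> real \<Rightarrow> real \<Rightarrow> real" where
  "kepler_profile_kx c x k = x * kepler_factor c x * (1 + kepler_tilt c x k) ^ 3 / (16 * kepler_tilt c x k)
    + (kepler_factor c x)\<^sup>2 * (1 + kepler_tilt c x k)\<^sup>2 * (2 * kepler_tilt c x k - 1)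
      / (64 * (kepler_tilt c x k)\<^sup>2) * kepler_tilt_x c x k"

definition kepler_profile_kk :: "real \<Rightarrow> real \<Rightarrow> real \<Rightarrow> real" where
  "kepler_profile_kk c x k = (kepler_factor c x)\<^sup>2 * (1 + kepler_tilt c x k)\<^sup>2 * (2 * kepler_tilt c x k - 1)
    / (64 * (kepler_tilt c x k)\<^sup>2) * kepler_tilt_k c x k"

definition kepler_domain :: "real \<Rightarrow> (real \<times> real) set" where
  "kepler_domain c = {(x, k). x > 0 \<and> kepler_sqnorm x k > 0 \<and>
    (kepler_factor c x)\<^sup>2 * sqrt (kepler_sqnorm x k) > 16}"

lemma kepler_domainD:
  assumes "(x, k) \<in> kepler_domain c"
  shows "x > 0" "kepler_sqnorm x k > 0" "(kepler_factor c x)\<^sup>2 * sqrt (kepler_sqnorm x k) > 16"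
    "kepler_factor c x \<noteq> 0" "kepler_tilt c x k > 0"
    "1 - 16 / ((kepler_factor c x)\<^sup>2 * sqrt (kepler_sqnorm x k)) > 0"
  using assms by (auto simp: kepler_domain_def kepler_tilt_def)

lemma open_kepler_domain: "open (kepler_domain c)"
proof -
  define H where "H = {p::real \<times> real. fst p > 0}"
  define f where "f = (\<lambda>p. min (kepler_sqnorm (fst p) (snd p))
    ((kepler_factor c (fst p))\<^sup>2 * sqrt (kepler_sqnorm (fst p) (snd p)) - 16))"
  have "continuous_on H f"
    unfolding f_def kepler_sqnorm_def kepler_factor_def H_def by (intro continuous_intros) auto
  moreover have "open H" unfolding H_def by (intro open_Collect_less continuous_intros)
  ultimately have "open (H \<inter> f -` {0<..})" by (intro continuous_open_preimage) auto
  moreover have "kepler_domain c = H \<inter> f -` {0<..}"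
    by (auto simp: kepler_domain_def H_def f_def)
  ultimately show ?thesis by simp
qed

lemma kepler_domain_equator:
  assumes "c > 3/2" "x > 0"
  shows "(x, 0) \<in> kepler_domain c"
  using kepler_factor_square_gt[OF assms(1), of x] assms(2)
  by (simp add: kepler_domain_def kepler_sqnorm_def real_sqrt_divide field_simps)

lemma Lstar_eq_kepler_profile:
  assumes "x > 0" "t > 0"
  shows "Lstar c x y r t = t\<^sup>2 * kepler_profile c x (r\<^sup>2 / t\<^sup>2)"
proof -
  have "r\<^sup>2 + t\<^sup>2 / x\<^sup>2 = t\<^sup>2 * kepler_sqnorm x (r\<^sup>2 / t\<^sup>2)"
    using assms by (simp add: kepler_sqnorm_def field_simps)
  then have "sqrt (r\<^sup>2 + t\<^sup>2 / x\<^sup>2) = t * sqrt (kepler_sqnorm x (r\<^sup>2 / t\<^sup>2))"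
    using assms by (simp add: real_sqrt_mult)
  moreover have "kepler_sqnorm x (r\<^sup>2 / t\<^sup>2) \<ge> 0" by (simp add: kepler_sqnorm_def)
  ultimately show ?thesis
    using assms(2) unfolding Lstar_def Fstar_def kepler_profile_def kepler_tilt_def
    by (simp add: kepler_factor_def power_mult_distrib power_divide mult_ac)
qed

lemma kepler_sqnorm_has_gradient:
  assumes "x > 0"
  shows "(kepler_sqnorm has_gradient (- 2 / x ^ 3, 1)) (x, k)"
proof -
  have "((\<lambda>x. 1 / x\<^sup>2) has_real_derivative - 2 / x ^ 3) (at x)"
    using assms by (auto intro!: derivative_eq_intros simp: field_simps power2_eq_square power3_eq_cube)
  from has_gradient_add[OF has_gradient_snd has_gradient_of_fst[OF this]] show ?thesis
    by (simp add: kepler_sqnorm_def[abs_def])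
qed

lemma kepler_factor_square_has_gradient:
  "((\<lambda>x k. (kepler_factor c x)\<^sup>2) has_gradient (4 * x * kepler_factor c x, 0)) (x, k)"
  unfolding kepler_factor_def by (intro has_gradient_of_fst) (auto intro!: derivative_eq_intros)

lemma kepler_tilt_has_gradient:
  assumes "(x, k) \<in> kepler_domain c"
  shows "(kepler_tilt c has_gradient (kepler_tilt_x c x k, kepler_tilt_k c x k)) (x, k)"
proof -
  note dom = kepler_domainD[OF assms]
  define A q g where "A = kepler_factor c x" and "q = sqrt (kepler_sqnorm x k)" and "g = kepler_tilt c x k"
  have s: "kepler_sqnorm x k = q\<^sup>2" and q: "q > 0" and A: "A \<noteq> 0" and g: "g > 0"
    using dom by (simp_all add: q_def A_def g_def)
  have g_eq: "g = sqrt (1 - 16 / (A\<^sup>2 * q))"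
    by (simp add: g_def kepler_tilt_def A_def q_def)
  then have rad: "1 - 16 / (A\<^sup>2 * q) > 0" using g by simp
  then have g2: "1 - g\<^sup>2 = 16 / (A\<^sup>2 * q)" by (simp add: g_eq)
  have "((\<lambda>h. sqrt (1 - 16 / h)) has_real_derivative 8 / ((A\<^sup>2 * q)\<^sup>2 * g)) (at (A\<^sup>2 * q))"
    using A q g rad unfolding g_eq
    by (auto intro!: derivative_eq_intros simp: field_simps power2_eq_square)
  from has_gradient_compose[OF has_gradient_mult[OF kepler_factor_square_has_gradient
      has_gradient_compose[OF kepler_sqnorm_has_gradient[OF dom(1)] DERIV_real_sqrt[OF dom(2)]]],
      OF this[unfolded A_def q_def], folded A_def q_def]
  have "((\<lambda>x k. kepler_tilt c x k) has_gradient
      (8 / ((A\<^sup>2 * q)\<^sup>2 * g) * (4 * x * A * q + A\<^sup>2 * (inverse q / 2 * (- 2 / x ^ 3))),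
       8 / ((A\<^sup>2 * q)\<^sup>2 * g) * (A\<^sup>2 * (inverse q / 2)))) (x, k)"
    by (simp add: kepler_tilt_def)
  moreover have "8 / ((A\<^sup>2 * q)\<^sup>2 * g) * (4 * x * A * q + A\<^sup>2 * (inverse q / 2 * (- 2 / x ^ 3)))
      = kepler_tilt_x c x k"
    unfolding kepler_tilt_x_def g_def[symmetric] g2 s A_def[symmetric]
    using A q g dom(1) by (simp add: field_simps power2_eq_square power3_eq_cube)
  moreover have "8 / ((A\<^sup>2 * q)\<^sup>2 * g) * (A\<^sup>2 * (inverse q / 2)) = kepler_tilt_k c x k"
    unfolding kepler_tilt_k_def g_def[symmetric] g2 s
    using A q g by (simp add: field_simps power2_eq_square)
  ultimately show ?thesis by simp
qed

lemma kepler_profile_has_gradient: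
  assumes "(x, k) \<in> kepler_domain c"
  shows "(kepler_profile c has_gradient (kepler_profile_x c x k, kepler_profile_k c x k)) (x, k)"
proof -
  note dom = kepler_domainD[OF assms]
  define A s g where "A = kepler_factor c x" and "s = kepler_sqnorm x k" and "g = kepler_tilt c x k"
  note folds = A_def[symmetric] s_def[symmetric] g_def[symmetric]
  have nonzero: "x \<noteq> 0" "A \<noteq> 0" "s \<noteq> 0" "g \<noteq> 0" using dom by (simp_all add: A_def s_def g_def)
  have "((\<lambda>g. (1 + g)\<^sup>2 / 32) has_real_derivative (1 + g) / 16) (at g)" for g :: real
    by (auto intro!: derivative_eq_intros)
  note has_gradient_mult[OF has_gradient_mult[OF kepler_factor_square_has_gradient
        kepler_sqnorm_has_gradient[OF dom(1)]]
      has_gradient_compose[OF kepler_tilt_has_gradient[OF assms] this], of c]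
  then have "(kepler_profile c has_gradient
     ((4 * x * A * s + A\<^sup>2 * (- 2 / x ^ 3)) * ((1 + g)\<^sup>2 / 32)
       + A\<^sup>2 * s * ((1 + g) / 16 * ((1 - g\<^sup>2) / (2 * g) * (4 * x / A - 1 / (x ^ 3 * s)))),
      A\<^sup>2 * ((1 + g)\<^sup>2 / 32) + A\<^sup>2 * s * ((1 + g) / 16 * ((1 - g\<^sup>2) / (4 * g * s))))) (x, k)"
    unfolding kepler_profile_def kepler_tilt_x_def kepler_tilt_k_def folds by simp
  then show ?thesis
    by (rule has_gradient_eq_rhs; unfold kepler_profile_x_def kepler_profile_k_def folds)
      (use nonzero in \<open>simp_all add: field_simps power2_eq_square power3_eq_cube\<close>)
qed

lemma kepler_profile_k_has_gradient:
  assumes "(x, k) \<in> kepler_domain c"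
  shows "(kepler_profile_k c has_gradient (kepler_profile_kx c x k, kepler_profile_kk c x k)) (x, k)"
proof -
  note dom = kepler_domainD[OF assms]
  have "((\<lambda>g. (1 + g) ^ 3 / (64 * g)) has_real_derivative (1 + g)\<^sup>2 * (2 * g - 1) / (64 * g\<^sup>2)) (at g)"
    if "g > 0" for g :: real
    using that by (auto intro!: derivative_eq_intros simp: field_simps power2_eq_square power3_eq_cube)
  from has_gradient_mult[OF kepler_factor_square_has_gradient
      has_gradient_compose[OF kepler_tilt_has_gradient[OF assms] this[OF dom(5)]], of c]
  show ?thesis
    unfolding kepler_profile_k_def times_divide_eq_right
    by (rule has_gradient_eq_rhs) (simp_all add: kepler_profile_kx_def kepler_profile_kk_def)
qed

lemma kepler_profile_x_DERIV:
  assumes "(x, k) \<in> kepler_domain c"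
  shows "(kepler_profile_x c x has_real_derivative kepler_profile_kx c x k) (at k)"
proof -
  note dom = kepler_domainD[OF assms]
  define A s g where "A = kepler_factor c x" and "s = kepler_sqnorm x k" and "g = kepler_tilt c x k"
  note folds = A_def[symmetric] s_def[symmetric] g_def[symmetric]
  have nonzero: "x \<noteq> 0" "A \<noteq> 0" "s \<noteq> 0" "g \<noteq> 0" using dom by (simp_all add: A_def s_def g_def)
  define g' where "g' = (1 - g\<^sup>2) / (4 * g * s)"
  have g: "(kepler_tilt c x has_real_derivative g') (at k)"
    using has_gradient_partial2[OF kepler_tilt_has_gradient[OF assms]]
    by (simp add: kepler_tilt_k_def g'_def folds)
  define f N' where "f = (\<lambda>k. 4 * x * A * kepler_sqnorm x k - A\<^sup>2 * (1 + kepler_tilt c x k) / x ^ 3)"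
    and "N' = 4 * x * A - A\<^sup>2 * g' / x ^ 3"
  define N where "N = f k"
  have f: "(f has_real_derivative N') (at k)"
    using nonzero unfolding f_def N'_def
    by (auto intro!: derivative_eq_intros g has_gradient_partial2[OF kepler_sqnorm_has_gradient[OF dom(1)]]
        simp: field_simps)
  have "kepler_profile_x c x = (\<lambda>k. (1 + kepler_tilt c x k)\<^sup>2 * f k / (32 * kepler_tilt c x k))"
    by (simp add: fun_eq_iff kepler_profile_x_def f_def A_def)
  then have "(kepler_profile_x c x has_real_derivative
      ((2 * (1 + g) * g' * N + (1 + g)\<^sup>2 * N') * g - (1 + g)\<^sup>2 * N * g') / (32 * g\<^sup>2)) (at k)"
    using nonzero
    by (auto intro!: derivative_eq_intros g f simp: folds N_def) (simp add: field_simps power2_eq_square)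
  moreover have "((2 * (1 + g) * g' * N + (1 + g)\<^sup>2 * N') * g - (1 + g)\<^sup>2 * N * g') / (32 * g\<^sup>2)
      = kepler_profile_kx c x k"
    unfolding kepler_profile_kx_def kepler_tilt_x_def folds g'_def N_def f_def N'_def
    using nonzero by (simp add: field_simps power2_eq_square power3_eq_cube)
  ultimately show ?thesis by simp
qed

lemma kepler_profile_C1:
  shows "kepler_profile_x c x C1_differentiable_on {k. (x, k) \<in> kepler_domain c}"
      (is "_ C1_differentiable_on ?S")
    and "kepler_profile_kx c x C1_differentiable_on {k. (x, k) \<in> kepler_domain c}"
    and "kepler_profile_kk c x C1_differentiable_on {k. (x, k) \<in> kepler_domain c}"
proof -
  have dom: "x \<noteq> 0" "kepler_sqnorm x k > 0" "kepler_factor c x \<noteq> 0" "kepler_tilt c x k \<noteq> 0"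
    "1 - 16 / ((kepler_factor c x)\<^sup>2 * sqrt (kepler_sqnorm x k)) > 0" if "k \<in> ?S" for k
    using kepler_domainD[of x k c] that by simp_all
  then have nonzero: "kepler_sqnorm x k \<noteq> 0" if "k \<in> ?S" for k using that by fastforce
  have s: "kepler_sqnorm x C1_differentiable_on ?S"
    unfolding kepler_sqnorm_def[abs_def] by (intro derivative_intros)
  have g: "kepler_tilt c x C1_differentiable_on ?S"
    unfolding kepler_tilt_def[abs_def]
    by (intro derivative_intros s) (use dom nonzero in simp_all)
  show "kepler_profile_x c x C1_differentiable_on ?S" "kepler_profile_kx c x C1_differentiable_on ?S"
    "kepler_profile_kk c x C1_differentiable_on ?S"
    unfolding kepler_profile_x_def[abs_def] kepler_profile_kx_def[abs_def] kepler_profile_kk_def[abs_def]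
      kepler_tilt_x_def kepler_tilt_k_def
    by (intro derivative_intros s g; use dom nonzero in simp)+
qed

lemma continuous_on_kepler_profile_kk:
  "continuous_on (kepler_domain c) (\<lambda>p. kepler_profile_kk c (fst p) (snd p))"
proof -
  have "fst p \<noteq> 0 \<and> kepler_sqnorm (fst p) (snd p) \<noteq> 0 \<and> kepler_factor c (fst p) \<noteq> 0 \<and>
      kepler_tilt c (fst p) (snd p) \<noteq> 0" if "p \<in> kepler_domain c" for p
    using kepler_domainD[of "fst p" "snd p" c] that by simp
  moreover from this have "continuous_on (kepler_domain c) (\<lambda>p. kepler_sqnorm (fst p) (snd p))"
    and "continuous_on (kepler_domain c) (\<lambda>p. kepler_factor c (fst p))"
    unfolding kepler_sqnorm_def kepler_factor_def by (auto intro!: continuous_intros)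
  moreover from calculation have "continuous_on (kepler_domain c) (\<lambda>p. kepler_tilt c (fst p) (snd p))"
    unfolding kepler_tilt_def by (auto intro!: continuous_intros)
  ultimately show ?thesis
    unfolding kepler_profile_kk_def kepler_tilt_k_def by (auto intro!: continuous_intros)
qed

lemma flagK_equator:
  assumes c: "c > 3/2" and x: "x > 0" and v: "v > 0"
    and m_xx: "((\<lambda>s. kepler_profile_x c s 0) has_real_derivative m_xx) (at x)"
  defines "m \<equiv> kepler_profile c x 0" and "m_x \<equiv> kepler_profile_x c x 0" and "m_k \<equiv> kepler_profile_k c x 0"
  shows "flagK c x y 0 v = m_k * m_xx / m + m_x * kepler_profile_kx c x 0 / (2 * m)
    - 3 * m_k * m_x\<^sup>2 / (2 * m\<^sup>2) + 3 * m_x\<^sup>2 * kepler_profile_kk c x 0 / (2 * m * m_k)"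
proof -
  have dom: "(x, 0) \<in> kepler_domain c" using c x by (rule kepler_domain_equator)
  have "kepler_profile c x 0 > 0" "kepler_profile_k c x 0 > 0"
    using kepler_domainD[OF dom]
    by (simp_all add: kepler_profile_def kepler_profile_k_def zero_less_mult_iff)
  then obtain M where M: "(x, 0) \<in> M" "M \<subseteq> kepler_domain c"
    and "even_profile M (kepler_profile c) (kepler_profile_x c) (kepler_profile_k c)
      (kepler_profile_kx c) (kepler_profile_kk c)"
    using even_profile_near[OF open_kepler_domain dom kepler_profile_has_gradient
        kepler_profile_k_has_gradient continuous_on_kepler_profile_kk] by metis
  then interpret even_profile M "kepler_profile c" "kepler_profile_x c" "kepler_profile_k c"
    "kepler_profile_kx c" "kepler_profile_kk c" by simp
  have x_pos: "s > 0" if "(s, k) \<in> M" for s k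
    using kepler_domainD(1) M(2) that by blast
  interpret profile_lagrangian M "kepler_profile c" "kepler_profile_x c" "kepler_profile_k c"
    "kepler_profile_kx c" "kepler_profile_kk c" "fibre_legendre (Lstar c)"
    by (rule profile_lagrangian_fibre_legendre)
      (use Lstar_eq_kepler_profile inj_Lstar_legendre[OF c] x_pos in blast)+
  have "open (Pair x -` kepler_domain c)"
    by (intro open_vimage open_kepler_domain continuous_intros)
  then have S: "open {k. (x, k) \<in> kepler_domain c}" by (simp add: vimage_def)
  show ?thesis
    unfolding flagK_eq m_def m_x_def m_k_def
    by (rule flag_curvature_equator[OF M(1) v S _ kepler_profile_C1 kepler_profile_x_DERIV[OF dom] m_xx])
      (use dom in simp)
qed

lemma kepler_chart_at_witness:
  "kepler_factor (38/25) (3/5) = 17/5" "kepler_sqnorm (3/5) 0 = 25/9" "kepler_tilt (38/25) (3/5) 0 = 7/17"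
  "kepler_tilt_x (38/25) (3/5) 0 = - 280/289" "kepler_tilt_k (38/25) (3/5) 0 = 108/595"
proof -
  show A: "kepler_factor (38/25) (3/5) = 17/5" and s: "kepler_sqnorm (3/5) 0 = 25/9"
    by (simp_all add: kepler_factor_def kepler_sqnorm_def power2_eq_square)
  have sqrt_s: "sqrt (25/9) = 5/3"
    by (rule real_sqrt_unique) (simp_all add: power2_eq_square)
  show g: "kepler_tilt (38/25) (3/5) 0 = 7/17"
    unfolding kepler_tilt_def A s sqrt_s
    by (rule real_sqrt_unique) (simp_all add: power2_eq_square)
  show "kepler_tilt_x (38/25) (3/5) 0 = - 280/289" "kepler_tilt_k (38/25) (3/5) 0 = 108/595"
    by (simp_all add: kepler_tilt_x_def kepler_tilt_k_def A s g power2_eq_square power3_eq_cube)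
qed

lemma kepler_profile_at_witness:
  "kepler_profile (38/25) (3/5) 0 = 2" "kepler_profile_x (38/25) (3/5) 0 = - 8"
  "kepler_profile_k (38/25) (3/5) 0 = 216/175" "kepler_profile_kx (38/25) (3/5) 0 = 216/175"
  "kepler_profile_kk (38/25) (3/5) 0 = - 2916/42875"
  by (simp_all add: kepler_profile_def kepler_profile_x_def kepler_profile_k_def kepler_profile_kx_def
      kepler_profile_kk_def kepler_chart_at_witness power2_eq_square power3_eq_cube)

lemma kepler_profile_x_DERIV_at_witness:
  "((\<lambda>s. kepler_profile_x (38/25) s 0) has_real_derivative 312/7) (at (3/5))"
proof -
  have dom: "(3/5, 0) \<in> kepler_domain (38/25)" by (rule kepler_domain_equator) simp_all
  have A: "(kepler_factor (38/25) has_real_derivative 6/5) (at (3/5))"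
    unfolding kepler_factor_def[abs_def] by (auto intro!: derivative_eq_intros)
  have s: "((\<lambda>x. kepler_sqnorm x 0) has_real_derivative - 250/27) (at (3/5))"
    using has_gradient_partial1[OF kepler_sqnorm_has_gradient[of "3/5" 0]] by (simp add: power3_eq_cube)
  have g: "((\<lambda>x. kepler_tilt (38/25) x 0) has_real_derivative - 280/289) (at (3/5))"
    using has_gradient_partial1[OF kepler_tilt_has_gradient[OF dom]] by (simp add: kepler_chart_at_witness)
  show ?thesis
    unfolding kepler_profile_x_def
    by (rule derivative_eq_intros A s g refl | simp add: kepler_chart_at_witness; fail)+
      (simp add: kepler_chart_at_witness power2_eq_square power3_eq_cube)
qed

theorem theoremB:
  shows "\<exists>c x y u v :: real. c > 3/2 \<and> x > 0 \<and> (u, v) \<noteq> (0, 0) \<and> v \<noteq> 0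
            \<and> flagK c x y u v < 0"
proof -
  have "flagK (38/25) (3/5) 0 0 1 = - 8856/1225"
    by (subst flagK_equator[OF _ _ _ kepler_profile_x_DERIV_at_witness])
      (simp_all add: kepler_profile_at_witness power2_eq_square)
  then show ?thesis
    by (intro exI[of _ "38/25"] exI[of _ "3/5"] exI[of _ 0] exI[of _ 1]) simp
qed

end
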